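(* Let $\mathbb K$ be the finite field with $q$ elements and $n\ge1$. For any $\pi\vdash[n]$, $$\mathrm{SPl}_n(\pi)=\frac{|\mathcal J_\pi|}{|U_n|}.$$ Equivalently, the superplancherel measure of $\pi$ is the probability that a uniformly random matrix in $U_n$ belongs to $\mathcal J_\pi$.
   Context: Set partitions. $[n]=\{1,\dots,n\}$; $\pi\vdash[n]$ means that $\pi$ is a set partition of $[n]$. A pair $(i,j)$ with $i<j$ is an arc of $\pi$ if $i,j$ lie in the same block and no $k$ with $i<k<j$ lies in that block. $D(\pi)$ is the set of arcs, $d(\pi)=|D(\pi)|$, $\dim(\pi)=\sum_{(i,j)\in D(\pi)}(j-i)$, and $\mathrm{crs}(\pi)$ is the number of unordered pairs of arcs $\{(i,j),(k,l)\}\subseteq D(\pi)$ with $i<k<j<l$. A pair $(i,j)$, $1\le i<j\le n$, is $\pi$-regular if there is no $k<i$ with $(k,j)\in D(\pi)$ and no $l>j$ with $(i,l)\in D(\pi)$; otherwise it is $\pi$-singular. $\mathrm{Reg}(\pi)$ and $\mathrm{Sing}(\pi)$ are the sets of $\pi$-regular and $\pi$-singular pairs. $U_n$ is the group of $n\times n$ upper unitriangular matrices over $\mathbb K$, $|U_n|=q^{n(n-1)/2}$. $\mathcal J_\pi\subseteq U_n$ is the set of $A\in U_n$ such that: $A_{i,j}\in\mathbb K\setminus\{0\}$ if $(i,j)\in D(\pi)$; $A_{i,j}=0$ if $(i,j)\in\mathrm{Reg}(\pi)\setminus D(\pi)$; $A_{i,j}\in\mathbb K$ is arbitrary if $(i,j)\in\mathrm{Sing}(\pi)$.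 Superplancherel measure. In the supercharacter theory of $U_n$ due to Bergeron and Thiem, the supercharacters $\chi^\pi$ are indexed by $\pi\vdash[n]$ and satisfy $\chi^\pi(1)=(q-1)^{d(\pi)}q^{\dim(\pi)-d(\pi)}$ and $\langle\chi^\pi,\chi^\pi\rangle=(q-1)^{d(\pi)}q^{\mathrm{crs}(\pi)}$. The superplancherel measure is $$\mathrm{SPl}_n(\pi)=\frac{1}{|U_n|}\frac{\chi^\pi(1)^2}{\langle\chi^\pi,\chi^\pi\rangle}=\frac{1}{q^{n(n-1)/2}}\,\frac{(q-1)^{d(\pi)}q^{2\dim(\pi)-2d(\pi)}}{q^{\mathrm{crs}(\pi)}}.$$ *)

theory Defs
  imports
    "Jordan_Normal_Form.Matrix"
    "HOL-Library.Disjoint_Sets"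
    "HOL-Library.FuncSet"
    "HOL-Probability.Probability_Mass_Function"
begin

text \<open>
  A set partition of \<open>[n]\<close> is a family \<open>\<pi>\<close> with \<open>partition_on {1..n} \<pi>\<close>.  Matrices of type
  \<open>'k mat\<close> are indexed from \<open>0\<close>, so the entry in row \<open>i\<close> and column \<open>j\<close> of a matrix with rows
  and columns numbered by \<open>1, \<dots>, n\<close> is \<open>A $$ (i - 1, j - 1)\<close>.  A finite field is a type
  \<open>'k\<close> of sort \<open>{field, finite}\<close>, with \<open>q = CARD('k)\<close>.
\<close>

definition arcs :: "nat set set \<Rightarrow> (nat \<times> nat) set" where
  "arcs \<pi> = {(i, j). i < j \<and> (\<exists>B\<in>\<pi>. i \<in> B \<and> j \<in> B \<and> (\<forall>k. i < k \<and> k < j \<longrightarrow> k \<notin> B))}"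

definition Reg :: "nat \<Rightarrow> nat set set \<Rightarrow> (nat \<times> nat) set" where
  "Reg n \<pi> = {(i, j). 1 \<le> i \<and> i < j \<and> j \<le> n \<and>
     \<not> (\<exists>k<i. (k, j) \<in> arcs \<pi>) \<and> \<not> (\<exists>l>j. (i, l) \<in> arcs \<pi>)}"

definition unitriangular :: "nat \<Rightarrow> 'k::{field,finite} mat set" where
  "unitriangular n =
     {A \<in> carrier_mat n n. upper_triangular A \<and> (\<forall>i<n. A $$ (i, i) = 1)}"

text \<open>Entries at singular positions are unconstrained, hence they do not occur below.\<close>

definition J_set :: "nat \<Rightarrow> nat set set \<Rightarrow> 'k::{field,finite} mat set" where
  "J_set n \<pi> = {A \<in> unitriangular n.
     (\<forall>(i, j) \<in> arcs \<pi>. A $$ (i - 1, j - 1) \<noteq> 0) \<and>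
     (\<forall>(i, j) \<in> Reg n \<pi> - arcs \<pi>. A $$ (i - 1, j - 1) = 0)}"

text \<open>
  The Bergeron--Thiem supercharacters.  Let \<open>\<nn>\<close> be the algebra of strictly upper triangular
  matrices.  Then \<open>U\<^sub>n = 1 + \<nn>\<close> acts from both sides on the dual space of \<open>\<nn>\<close>, and for a
  nontrivial additive character \<open>\<theta>\<close> of the field the algebra group supercharacter of
  \<open>\<lambda> \<in> \<nn>\<^sup>*\<close> is
    \<open>\<chi>\<^sup>\<lambda>(u) = |U\<^sub>n \<lambda>| / |U\<^sub>n \<lambda> U\<^sub>n| \<cdot> (\<Sum>\<mu> \<in> U\<^sub>n \<lambda> U\<^sub>n. \<theta> (\<mu> (u - 1)))\<close>
  (Andre, Yan, Diaconis--Isaacs).  The supercharacter \<open>\<chi>\<^sup>\<pi>\<close> of the coarser theory is the sum of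
  \<open>\<chi>\<^sup>\<lambda>\<close> over the \<open>(q - 1) ^ d(\<pi>)\<close> functionals \<open>\<lambda>\<close> whose support is exactly the set of arcs of
  \<open>\<pi>\<close>; these form one orbit of the diagonal torus.  It does not depend on the choice of \<open>\<theta>\<close>.
\<close>

definition nontrivial_additive_character :: "('k::{field,finite} \<Rightarrow> complex) \<Rightarrow> bool" where
  "nontrivial_additive_character \<theta> \<longleftrightarrow>
     \<theta> 0 = 1 \<and> (\<forall>x y. \<theta> (x + y) = \<theta> x * \<theta> y) \<and> (\<exists>x. \<theta> x \<noteq> 1)"

definition strict_upper :: "nat \<Rightarrow> 'k::{field,finite} mat set" where
  "strict_upper n = {X \<in> carrier_mat n n. \<forall>i<n. \<forall>j\<le>i. X $$ (i, j) = 0}"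

text \<open>
  Functionals are made extensional by restriction to \<open>strict_upper n\<close>, so that orbits are
  counted as sets of maps on \<open>\<nn>\<close>.  The left action is \<open>(u \<lambda>)(X) = \<lambda>(u\<^sup>-\<^sup>1 X)\<close>, and similarly on the
  right; as \<open>u\<close> runs over a group, the inverses can be omitted in the description of orbits.
\<close>

definition arc_functional ::
  "nat \<Rightarrow> nat set set \<Rightarrow> (nat \<times> nat \<Rightarrow> 'k::{field,finite}) \<Rightarrow> 'k mat \<Rightarrow> 'k" where
  "arc_functional n \<pi> c =
     (\<lambda>X\<in>strict_upper n. \<Sum>(i, j)\<in>arcs \<pi>. c (i, j) * X $$ (i - 1, j - 1))"

definition left_orbit ::
  "nat \<Rightarrow> ('k::{field,finite} mat \<Rightarrow> 'k) \<Rightarrow> ('k mat \<Rightarrow> 'k) set" where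
  "left_orbit n l = {(\<lambda>X\<in>strict_upper n. l (u * X)) | u. u \<in> unitriangular n}"

definition two_sided_orbit ::
  "nat \<Rightarrow> ('k::{field,finite} mat \<Rightarrow> 'k) \<Rightarrow> ('k mat \<Rightarrow> 'k) set" where
  "two_sided_orbit n l =
     {(\<lambda>X\<in>strict_upper n. l (u * X * v)) | u v. u \<in> unitriangular n \<and> v \<in> unitriangular n}"

definition functional_supercharacter ::
  "('k::{field,finite} \<Rightarrow> complex) \<Rightarrow> nat \<Rightarrow> ('k mat \<Rightarrow> 'k) \<Rightarrow> 'k mat \<Rightarrow> complex" where
  "functional_supercharacter \<theta> n l u =
     of_nat (card (left_orbit n l)) / of_nat (card (two_sided_orbit n l)) *
     (\<Sum>m\<in>two_sided_orbit n l. \<theta> (m (u - 1\<^sub>m n)))"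

definition supercharacter ::
  "('k::{field,finite} \<Rightarrow> complex) \<Rightarrow> nat \<Rightarrow> nat set set \<Rightarrow> 'k mat \<Rightarrow> complex" where
  "supercharacter \<theta> n \<pi> u =
     (\<Sum>c\<in>arcs \<pi> \<rightarrow>\<^sub>E (UNIV - {0}). functional_supercharacter \<theta> n (arc_functional n \<pi> c) u)"

definition char_inner ::
  "nat \<Rightarrow> ('k::{field,finite} mat \<Rightarrow> complex) \<Rightarrow> ('k mat \<Rightarrow> complex) \<Rightarrow> complex" where
  "char_inner n \<phi> \<psi> =
     (\<Sum>u\<in>unitriangular n. \<phi> u * cnj (\<psi> u)) / of_nat (card (unitriangular n :: 'k mat set))"

text \<open>The value is a nonnegative real number, but it is formed in \<open>\<complex>\<close>.\<close>

definition SPl :: "('k::{field,finite} \<Rightarrow> complex) \<Rightarrow> nat \<Rightarrow> nat set set \<Rightarrow> complex" where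
  "SPl \<theta> n \<pi> =
     1 / of_nat (card (unitriangular n :: 'k mat set)) *
     ((supercharacter \<theta> n \<pi> (1\<^sub>m n))\<^sup>2 /
      char_inner n (supercharacter \<theta> n \<pi>) (supercharacter \<theta> n \<pi>))"

end

theory Submission
  imports Defs "Jordan_Normal_Form.Determinant"
begin

text \<open>
  The orbits \<open>U\<^sub>n \<lambda> U\<^sub>n\<close> of the functionals \<open>\<lambda>\<close> supported exactly on the arcs of \<open>\<pi>\<close> are pairwise
  disjoint; let \<open>W\<close> be their union.  Since \<open>|U\<^sub>n \<lambda>| / |U\<^sub>n \<lambda> U\<^sub>n|\<close> is the same number \<open>k\<close> for all these
  \<open>\<lambda>\<close>, the supercharacter is \<open>\<chi>\<^sup>\<pi>(u) = k \<cdot> (\<Sum>\<mu>\<in>W. \<theta> (\<mu> (u - 1)))\<close>.  Hence \<open>\<chi>\<^sup>\<pi>(1) = k |W|\<close>, and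
  \<open>\<langle>\<chi>\<^sup>\<pi>, \<chi>\<^sup>\<pi>\<rangle> = k\<^sup>2 |W|\<close> by orthogonality of the characters \<open>\<theta> \<circ> \<mu>\<close>, so that
  \<open>SPl\<^sub>n(\<pi>) = |W| / |U\<^sub>n|\<close>.

  It remains to see \<open>|W| = |J\<^sub>\<pi>|\<close>, that is, \<open>|U\<^sub>n \<lambda> U\<^sub>n| = q ^ |Sing(\<pi>)|\<close>.  The one-sided orbits are
  affine coordinate subspaces: in \<open>U\<^sub>n \<lambda>\<close> the coordinates below an arc are free, in \<open>\<lambda> U\<^sub>n\<close> those to the
  left of an arc, and all others are fixed.  A position is singular iff it is of one of these two
  kinds, and \<open>|U\<^sub>n \<lambda>| |\<lambda> U\<^sub>n| = |U\<^sub>n \<lambda> \<inter> \<lambda> U\<^sub>n| |U\<^sub>n \<lambda> U\<^sub>n|\<close>.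
\<close>

section \<open>Arcs, regular and singular positions\<close>

definition pos :: "nat \<Rightarrow> (nat \<times> nat) set" where
  "pos n = {(i, j). 1 \<le> i \<and> i < j \<and> j \<le> n}"

definition below_arc :: "nat \<Rightarrow> nat set set \<Rightarrow> (nat \<times> nat) set" where
  "below_arc n \<pi> = {(k, j) \<in> pos n. \<exists>i<k. (i, j) \<in> arcs \<pi>}"

definition left_of_arc :: "nat \<Rightarrow> nat set set \<Rightarrow> (nat \<times> nat) set" where
  "left_of_arc n \<pi> = {(i, l) \<in> pos n. \<exists>j>l. (i, j) \<in> arcs \<pi>}"

lemma finite_pos [simp]: "finite (pos n)"
  by (rule finite_subset[of _ "{..n} \<times> {..n}"]) (auto simp: pos_def)

text \<open>The singular pairs are split by the one-sided action that frees them. The two kinds may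
  overlap: a pair \<open>(k, j)\<close> of both kinds has arcs \<open>(i, j)\<close> and
  \<open>(k, l)\<close> with \<open>i < k < j < l\<close>, so the overlap records the
  crossings.\<close>

lemma Reg_eq: "Reg n \<pi> = pos n - (below_arc n \<pi> \<union> left_of_arc n \<pi>)"
  by (auto simp: Reg_def pos_def below_arc_def left_of_arc_def)

lemma arcs_subset_pos:
  assumes "partition_on {1..n} \<pi>"
  shows "arcs \<pi> \<subseteq> pos n"
proof -
  have "\<Union>\<pi> = {1..n}" using assms by (simp add: partition_on_def)
  then have "\<And>B k. B \<in> \<pi> \<Longrightarrow> k \<in> B \<Longrightarrow> 1 \<le> k \<and> k \<le> n"
    by (metis UnionI atLeastAtMost_iff)
  then show ?thesis
    unfolding arcs_def pos_def by blast
qed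

text \<open>Two blocks containing \<open>i\<close> coincide, and the right neighbour of
  \<open>i\<close> inside a block is unique. Together with its mirror image \<open>arcs_inj\<close>
  this puts at most one arc in each row and in each column.\<close>

lemma arcs_fun:
  assumes "partition_on A \<pi>" "(i, j) \<in> arcs \<pi>" "(i, j') \<in> arcs \<pi>"
  shows "j = j'"
proof -
  obtain B C where B: "B \<in> \<pi>" "i \<in> B" "j \<in> B" "i < j" "\<forall>k. i < k \<and> k < j \<longrightarrow> k \<notin> B"
    and C: "C \<in> \<pi>" "i \<in> C" "j' \<in> C" "i < j'" "\<forall>k. i < k \<and> k < j' \<longrightarrow> k \<notin> C"
    using assms by (auto simp: arcs_def)
  have "B = C"
    using partition_onD2[OF assms(1)] B C by (auto simp: disjoint_def)
  then show ?thesis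
    using B C by (metis linorder_neqE_nat)
qed

lemma arcs_inj:
  assumes "partition_on A \<pi>" "(i, j) \<in> arcs \<pi>" "(i', j) \<in> arcs \<pi>"
  shows "i = i'"
proof -
  obtain B C where B: "B \<in> \<pi>" "i \<in> B" "j \<in> B" "i < j" "\<forall>k. i < k \<and> k < j \<longrightarrow> k \<notin> B"
    and C: "C \<in> \<pi>" "i' \<in> C" "j \<in> C" "i' < j" "\<forall>k. i' < k \<and> k < j \<longrightarrow> k \<notin> C"
    using assms by (auto simp: arcs_def)
  have "B = C"
    using partition_onD2[OF assms(1)] B C by (auto simp: disjoint_def)
  then show ?thesis
    using B C by (metis linorder_neqE_nat)
qed

text \<open>An arc lying below another arc would share its right end with it, and an arc lying to
  the left of another would share its left end; uniqueness of neighbours excludes both.\<close>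

lemma arcs_disjoint_singular:
  assumes "partition_on {1..n} \<pi>"
  shows "arcs \<pi> \<inter> (below_arc n \<pi> \<union> left_of_arc n \<pi>) = {}"
proof -
  have "(i, j) \<notin> below_arc n \<pi> \<union> left_of_arc n \<pi>" if "(i, j) \<in> arcs \<pi>" for i j
    unfolding below_arc_def left_of_arc_def
    using arcs_fun[OF assms that] arcs_inj[OF assms that] less_irrefl by blast
  then show ?thesis by auto
qed

section \<open>Unitriangular matrices\<close>

text \<open>Coordinates use the 1-based numbering of \<open>arcs\<close>, matrices the 0-based one,
  hence the \<open>Suc\<close>. Functions extensional on \<open>pos n\<close> thereby parametrise
  the unitriangular matrices; \<open>unip_restrict\<close> and \<open>restrict_unip\<close> are the
  two inverse laws.\<close>

definition unip :: "nat \<Rightarrow> (nat \<times> nat \<Rightarrow> 'k) \<Rightarrow> 'k::{field,finite} mat" where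
  "unip n m = Matrix.mat n n (\<lambda>(i, j). if i = j then 1 else if i < j then m (Suc i, Suc j) else 0)"

lemma unip_unitriangular [simp]: "unip n m \<in> unitriangular n"
  by (auto simp: unip_def unitriangular_def)

lemma unip_entry:
  "\<lbrakk>1 \<le> i; i \<le> n; 1 \<le> j; j \<le> n\<rbrakk> \<Longrightarrow>
    unip n m $$ (i - 1, j - 1) = (if i = j then 1 else if i < j then m (i, j) else 0)"
  by (auto simp: unip_def)

lemma unitriangular_carrier: "u \<in> unitriangular n \<Longrightarrow> u \<in> carrier_mat n n"
  by (simp add: unitriangular_def)

lemma strict_upper_carrier: "X \<in> strict_upper n \<Longrightarrow> X \<in> carrier_mat n n"
  by (simp add: strict_upper_def)

lemma unitriangular_diag:
  "\<lbrakk>u \<in> unitriangular n; 1 \<le> i; i \<le> n\<rbrakk> \<Longrightarrow> u $$ (i - 1, i - 1) = 1"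
  by (simp add: unitriangular_def)

lemma unitriangular_low:
  "\<lbrakk>u \<in> unitriangular n; 1 \<le> j; j < i; i \<le> n\<rbrakk> \<Longrightarrow> u $$ (i - 1, j - 1) = 0"
  unfolding unitriangular_def upper_triangular_def by auto

lemma strict_upper_low:
  "\<lbrakk>X \<in> strict_upper n; 1 \<le> j; j \<le> i; i \<le> n\<rbrakk> \<Longrightarrow> X $$ (i - 1, j - 1) = 0"
  by (auto simp: strict_upper_def)

lemma unip_restrict:
  assumes "A \<in> unitriangular n"
  shows "unip n (\<lambda>(i, j)\<in>pos n. A $$ (i - 1, j - 1)) = A"
  by (rule eq_matI)
    (use assms in \<open>auto simp: unip_def pos_def unitriangular_def upper_triangular_def\<close>)

lemma restrict_unip:
  assumes "m \<in> extensional (pos n)"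
  shows "(\<lambda>(i, j)\<in>pos n. unip n m $$ (i - 1, j - 1)) = m"
proof
  fix p :: "nat \<times> nat"
  obtain i j where p: "p = (i, j)" by force
  show "(\<lambda>(i, j)\<in>pos n. unip n m $$ (i - 1, j - 1)) p = m p"
    using assms by (auto simp: p restrict_def pos_def unip_entry[unfolded One_nat_def] extensional_def)
qed

lemma finite_unitriangular [simp]: "finite (unitriangular n :: 'k::{field,finite} mat set)"
proof (rule finite_subset)
  show "unitriangular n \<subseteq> unip n ` (pos n \<rightarrow>\<^sub>E (UNIV :: 'k set))"
  proof
    fix A :: "'k mat" assume "A \<in> unitriangular n"
    then show "A \<in> unip n ` (pos n \<rightarrow>\<^sub>E UNIV)"
      by (intro image_eqI[where x = "\<lambda>(i, j)\<in>pos n. A $$ (i - 1, j - 1)"])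
        (auto simp: unip_restrict[unfolded One_nat_def])
  qed
qed (simp add: finite_PiE)

section \<open>The group structure of the unitriangular matrices\<close>

lemma mult_entry:
  assumes "A \<in> carrier_mat n n" "B \<in> carrier_mat n n" "1 \<le> i" "i \<le> n" "1 \<le> j" "j \<le> n"
  shows "(A * B) $$ (i - 1, j - 1) = (\<Sum>k=1..n. A $$ (i - 1, k - 1) * B $$ (k - 1, j - 1))"
proof -
  have "(A * B) $$ (i - 1, j - 1) = (\<Sum>k<n. A $$ (i - 1, k) * B $$ (k, j - 1))"
    using assms by (auto simp: scalar_prod_def atLeast0LessThan intro!: sum.cong)
  also have "\<dots> = (\<Sum>k=1..n. A $$ (i - 1, k - 1) * B $$ (k - 1, j - 1))"
    by (rule sum.reindex_bij_witness[of _ "\<lambda>k. k - 1" Suc]) auto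
  finally show ?thesis .
qed

lemma unitriangular_mult:
  assumes "A \<in> unitriangular n" "B \<in> unitriangular n"
  shows "A * B \<in> unitriangular n"
proof -
  have A: "A \<in> carrier_mat n n" "\<And>i j. j < i \<Longrightarrow> i < n \<Longrightarrow> A $$ (i, j) = 0" "\<And>i. i < n \<Longrightarrow> A $$ (i, i) = 1"
   and B: "B \<in> carrier_mat n n" "\<And>i j. j < i \<Longrightarrow> i < n \<Longrightarrow> B $$ (i, j) = 0" "\<And>i. i < n \<Longrightarrow> B $$ (i, i) = 1"
    using assms by (auto simp: unitriangular_def upper_triangular_def)
  have ent: "(A * B) $$ (i, j) = (\<Sum>k<n. A $$ (i, k) * B $$ (k, j))" if "i < n" "j < n" for i j
    using A(1) B(1) that by (auto simp: scalar_prod_def atLeast0LessThan intro!: sum.cong)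
  have "(A * B) $$ (i, j) = 0" if "j < i" "i < n" for i j
  proof -
    have "A $$ (i, k) * B $$ (k, j) = 0" if "k < n" for k
      using A(2)[of k i] B(2)[of j k] \<open>j < i\<close> \<open>i < n\<close> that by (cases "k < i") auto
    then show ?thesis using that by (auto simp: ent intro!: sum.neutral)
  qed
  moreover have "(A * B) $$ (i, i) = 1" if "i < n" for i
  proof -
    have "A $$ (i, k) * B $$ (k, i) = (if k = i then 1 else 0)" if "k < n" for k
      using A(2)[of k i] B(2)[of i k] A(3) B(3) \<open>i < n\<close> that by (cases k i rule: linorder_cases) auto
    then show ?thesis using that by (simp add: ent)
  qed
  ultimately show ?thesis
    using A(1) B(1) by (auto simp: unitriangular_def upper_triangular_def)
qed

lemma one_unitriangular [simp]: "1\<^sub>m n \<in> unitriangular n"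
  by (auto simp: unitriangular_def upper_triangular_def)

text \<open>The determinant is 1, which yields a left inverse \<open>C\<close> among all matrices,
  and \<open>C\<close> allows \<open>A\<close> to be cancelled. So left multiplication by
  \<open>A\<close> is an injective self-map of the finite set \<open>unitriangular n\<close>, hence
  surjective, and the preimage of the identity is an inverse that is again unitriangular.\<close>

lemma unitriangular_inverse:
  assumes "A \<in> unitriangular n"
  obtains B where "B \<in> unitriangular n" "A * B = 1\<^sub>m n" "B * A = 1\<^sub>m n"
proof -
  have A: "A \<in> carrier_mat n n" "upper_triangular A" and diag: "\<forall>i<n. A $$ (i, i) = 1"
    using assms by (auto simp: unitriangular_def)
  have "Determinant.det A = prod_list (diag_mat A)"
    by (rule det_upper_triangular[OF A(2,1)])
  also have "diag_mat A = map (\<lambda>i. 1) [0..<n]"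
    using A diag by (auto simp: diag_mat_def)
  finally have "Determinant.det A = 1" by (simp add: map_replicate_const)
  then obtain C where C: "C \<in> carrier_mat n n" "C * A = 1\<^sub>m n" 
    using det_non_zero_imp_unit[OF A(1)] by (auto simp: Units_def ring_mat_def)
  have inj: "inj_on ((*) A) (unitriangular n)"
  proof (rule inj_onI)
    fix X Y assume X: "X \<in> unitriangular n" and Y: "Y \<in> unitriangular n" and eq: "A * X = A * Y"
    have "C * (A * X) = C * (A * Y)" using eq by simp
    then show "X = Y"
      using C(2) assoc_mult_mat[OF C(1) A(1) unitriangular_carrier[OF X]]
        assoc_mult_mat[OF C(1) A(1) unitriangular_carrier[OF Y]] X Y
      by (simp add: left_mult_one_mat[OF unitriangular_carrier])
  qed
  have "(*) A ` unitriangular n = unitriangular n"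
    by (rule endo_inj_surj) (use inj assms in \<open>auto intro: unitriangular_mult\<close>)
  then obtain B where B: "B \<in> unitriangular n" "A * B = 1\<^sub>m n"
    by (metis imageE one_unitriangular)
  moreover have "B * A = 1\<^sub>m n"
    using mat_mult_left_right_inverse[OF A(1) unitriangular_carrier[OF B(1)] B(2)] .
  ultimately show thesis using that by blast
qed

text \<open>The inverse laws in the form of cancellation rules, with which simplification can verify
  the coset bijections below.\<close>

lemma unitriangular_cancel:
  assumes "A \<in> unitriangular n"
  obtains B where "B \<in> unitriangular n"
    "\<And>X. X \<in> carrier_mat n n \<Longrightarrow> A * (B * X) = X"
    "\<And>X. X \<in> carrier_mat n n \<Longrightarrow> B * (A * X) = X"
    "\<And>X. X \<in> carrier_mat n n \<Longrightarrow> X * A * B = X"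
    "\<And>X. X \<in> carrier_mat n n \<Longrightarrow> X * B * A = X"
proof -
  obtain B where B: "B \<in> unitriangular n" "A * B = 1\<^sub>m n" "B * A = 1\<^sub>m n"
    using unitriangular_inverse[OF assms] .
  note c = unitriangular_carrier[OF assms] unitriangular_carrier[OF B(1)]
  show thesis
  proof (rule that[OF B(1)])
    fix X :: "'a mat" assume X: "X \<in> carrier_mat n n"
    show "A * (B * X) = X" using assoc_mult_mat[OF c X] B X by simp
    show "B * (A * X) = X" using assoc_mult_mat[OF c(2,1) X] B X by simp
    show "X * A * B = X" using assoc_mult_mat[OF X c] B X by simp
    show "X * B * A = X" using assoc_mult_mat[OF X c(2,1)] B X by simp
  qed
qed

section \<open>The two-sided action on strictly upper triangular matrices\<close>

lemma strict_upper_mult_left: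
  assumes "u \<in> unitriangular n" "X \<in> strict_upper n"
  shows "u * X \<in> strict_upper n"
proof -
  have u: "u \<in> carrier_mat n n" "\<And>i j. j < i \<Longrightarrow> i < n \<Longrightarrow> u $$ (i, j) = 0"
   and X: "X \<in> carrier_mat n n" "\<And>i j. j \<le> i \<Longrightarrow> i < n \<Longrightarrow> X $$ (i, j) = 0"
    using assms by (auto simp: unitriangular_def upper_triangular_def strict_upper_def)
  have "(u * X) $$ (i, j) = 0" if "j \<le> i" "i < n" for i j
  proof -
    have "u $$ (i, k) * X $$ (k, j) = 0" if "k < n" for k
      using u(2)[of k i] X(2)[of j k] \<open>j \<le> i\<close> \<open>i < n\<close> that by (cases "k < i") auto
    then show ?thesis using that u(1) X(1) by (auto simp: scalar_prod_def intro!: sum.neutral)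
  qed
  then show ?thesis using u X by (auto simp: strict_upper_def)
qed

lemma strict_upper_mult_right:
  assumes "v \<in> unitriangular n" "X \<in> strict_upper n"
  shows "X * v \<in> strict_upper n"
proof -
  have v: "v \<in> carrier_mat n n" "\<And>i j. j < i \<Longrightarrow> i < n \<Longrightarrow> v $$ (i, j) = 0"
   and X: "X \<in> carrier_mat n n" "\<And>i j. j \<le> i \<Longrightarrow> i < n \<Longrightarrow> X $$ (i, j) = 0"
    using assms by (auto simp: unitriangular_def upper_triangular_def strict_upper_def)
  have "(X * v) $$ (i, j) = 0" if "j \<le> i" "i < n" for i j
  proof -
    have "X $$ (i, k) * v $$ (k, j) = 0" if "k < n" for k
      using v(2)[of j k] X(2)[of k i] \<open>j \<le> i\<close> \<open>i < n\<close> that by (cases "k \<le> i") auto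
    then show ?thesis using that v(1) X(1) by (auto simp: scalar_prod_def intro!: sum.neutral)
  qed
  then show ?thesis using v X by (auto simp: strict_upper_def)
qed

lemma two_sided_assoc:
  assumes "u \<in> unitriangular n" "a \<in> unitriangular n" "b \<in> unitriangular n" "v \<in> unitriangular n"
    "X \<in> strict_upper n"
  shows "(u * a) * X * (b * v) = u * (a * X * b) * v"
  using assms by (simp add: unitriangular_carrier strict_upper_carrier unitriangular_mult
      strict_upper_mult_left strict_upper_mult_right assoc_mult_mat[of _ n n _ n _ n])

section \<open>Orbits of a functional\<close>

text \<open>Takes the role of the orbit-stabiliser theorem: \<open>f\<close> will send a group
  element to the translated functional, so its image is the orbit, and \<open>s\<close> will be the
  order of the stabiliser.\<close>

lemma card_eq_fibre_mult:
  assumes "finite G" "\<And>g. g \<in> G \<Longrightarrow> card {h \<in> G. f h = f g} = s"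
  shows "card G = s * card (f ` G)"
proof -
  have "card G = (\<Sum>y\<in>f ` G. card {h \<in> G. f h = y})"
    using sum.image_gen[OF assms(1), of "\<lambda>_. 1::nat" f] by simp
  also have "\<dots> = (\<Sum>y\<in>f ` G. s)"
    using assms(2) by (intro sum.cong) auto
  finally show ?thesis by simp
qed

section \<open>Fibres of the orbit maps and orbit counting\<close>

definition right_orbit ::
  "nat \<Rightarrow> ('k::{field,finite} mat \<Rightarrow> 'k) \<Rightarrow> ('k mat \<Rightarrow> 'k) set" where
  "right_orbit n l = {(\<lambda>X\<in>strict_upper n. l (X * v)) | v. v \<in> unitriangular n}"

lemma restrict_eq_iff: "(\<lambda>x\<in>A. f x) = (\<lambda>x\<in>A. g x) \<longleftrightarrow> (\<forall>x\<in>A. f x = g x)"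
  by (metis restrict_apply' restrict_ext)

text \<open>The fibre through \<open>g\<close> is the coset of the stabiliser under right
  multiplication by \<open>g\<close>: since \<open>g * X\<close> is again strictly upper, a
  stabilising \<open>s\<close> satisfies \<open>l (s * (g * X)) = l (g * X)\<close>.\<close>

lemma card_left_fibre:
  fixes l :: "'k::{field,finite} mat \<Rightarrow> 'k"
  assumes g: "g \<in> unitriangular n"
  shows "card {u \<in> unitriangular n. \<forall>X\<in>strict_upper n. l (u * X) = l (g * X)} =
         card {u \<in> unitriangular n. \<forall>X\<in>strict_upper n. l (u * X) = l X}"
proof -
  obtain h where h: "h \<in> unitriangular n" and
    c: "\<And>X. X \<in> carrier_mat n n \<Longrightarrow> g * (h * X) = X"
       "\<And>X. X \<in> carrier_mat n n \<Longrightarrow> X * g * h = X" "\<And>X. X \<in> carrier_mat n n \<Longrightarrow> X * h * g = X"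
    using unitriangular_cancel[OF g] by metis
  have "bij_betw (\<lambda>s. s * g)
     {u \<in> unitriangular n. \<forall>X\<in>strict_upper n. l (u * X) = l X}
     {u \<in> unitriangular n. \<forall>X\<in>strict_upper n. l (u * X) = l (g * X)}"
    by (rule bij_betw_byWitness[where f' = "\<lambda>u. u * h"])
      (use c g h in \<open>auto simp: unitriangular_carrier strict_upper_carrier unitriangular_mult
        strict_upper_mult_left assoc_mult_mat[of _ n n _ n _ n]\<close>)
  then show ?thesis by (simp add: bij_betw_same_card)
qed

lemma card_right_fibre:
  fixes l :: "'k::{field,finite} mat \<Rightarrow> 'k"
  assumes g: "g \<in> unitriangular n"
  shows "card {v \<in> unitriangular n. \<forall>X\<in>strict_upper n. l (X * v) = l (X * g)} =
         card {v \<in> unitriangular n. \<forall>X\<in>strict_upper n. l (X * v) = l X}"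
proof -
  obtain h where h: "h \<in> unitriangular n" and
    c: "\<And>X. X \<in> carrier_mat n n \<Longrightarrow> X * h * g = X"
       "\<And>X. X \<in> carrier_mat n n \<Longrightarrow> g * (h * X) = X" "\<And>X. X \<in> carrier_mat n n \<Longrightarrow> h * (g * X) = X"
    using unitriangular_cancel[OF g] by metis
  have "bij_betw (\<lambda>s. g * s)
     {v \<in> unitriangular n. \<forall>X\<in>strict_upper n. l (X * v) = l X}
     {v \<in> unitriangular n. \<forall>X\<in>strict_upper n. l (X * v) = l (X * g)}"
    by (rule bij_betw_byWitness[where f' = "\<lambda>u. h * u"])
      (use c g h in \<open>auto simp: unitriangular_carrier strict_upper_carrier unitriangular_mult
        strict_upper_mult_right assoc_mult_mat[of _ n n _ n _ n, symmetric]\<close>)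
  then show ?thesis by (simp add: bij_betw_same_card)
qed

text \<open>The coset argument for pairs: \<open>(s, t)\<close> in the stabiliser corresponds to
  \<open>(s * g, g' * t)\<close> in the fibre.\<close>

lemma card_two_sided_fibre:
  fixes l :: "'k::{field,finite} mat \<Rightarrow> 'k"
  assumes g: "g \<in> unitriangular n" and g': "g' \<in> unitriangular n"
  shows "card {(u, v) \<in> unitriangular n \<times> unitriangular n.
               \<forall>X\<in>strict_upper n. l (u * X * v) = l (g * X * g')} =
         card {(u, v) \<in> unitriangular n \<times> unitriangular n.
               \<forall>X\<in>strict_upper n. l (u * X * v) = l X}"
proof -
  obtain h where h: "h \<in> unitriangular n" and
    c: "\<And>X. X \<in> carrier_mat n n \<Longrightarrow> g * (h * X) = X"
       "\<And>X. X \<in> carrier_mat n n \<Longrightarrow> X * g * h = X" "\<And>X. X \<in> carrier_mat n n \<Longrightarrow> X * h * g = X"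
    using unitriangular_cancel[OF g] by metis
  obtain h' where h': "h' \<in> unitriangular n" and
    c': "\<And>X. X \<in> carrier_mat n n \<Longrightarrow> X * h' * g' = X"
       "\<And>X. X \<in> carrier_mat n n \<Longrightarrow> g' * (h' * X) = X" "\<And>X. X \<in> carrier_mat n n \<Longrightarrow> h' * (g' * X) = X"
    using unitriangular_cancel[OF g'] by metis
  define S where "S = {(u, v) \<in> unitriangular n \<times> unitriangular n.
               \<forall>X\<in>strict_upper n. l (u * X * v) = l X}"
  define T where "T = {(u, v) \<in> unitriangular n \<times> unitriangular n.
               \<forall>X\<in>strict_upper n. l (u * X * v) = l (g * X * g')}"
  \<comment> \<open>To carry the fibre back into the stabiliser, its defining equation is evaluated
    at \<open>h * X * h'\<close>, where the right-hand side becomes \<open>l X\<close>.\<close>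
  have hX: "g * (h * X * h') * g' = X" if X: "X \<in> strict_upper n" for X
  proof -
    have "g * (h * X * h') = g * (h * X) * h'"
      using assoc_mult_mat[of g n n "h * X" n h' n] X g h h'
      by (simp add: unitriangular_carrier strict_upper_carrier strict_upper_mult_left)
    then show ?thesis
      using c(1) c'(1) X by (simp add: strict_upper_carrier)
  qed
  have "bij_betw (\<lambda>(s, t). (s * g, g' * t)) S T"
  proof (rule bij_betw_byWitness[where f' = "\<lambda>(u, v). (u * h, h' * v)"])
    show "(\<lambda>(s, t). (s * g, g' * t)) ` S \<subseteq> T"
      using g g' by (auto simp: S_def T_def unitriangular_mult two_sided_assoc
          strict_upper_mult_left strict_upper_mult_right)
    show "(\<lambda>(s, t). (s * h, h' * t)) ` T \<subseteq> S"
      using h h' by (auto simp: S_def T_def unitriangular_mult two_sided_assoc hX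
          strict_upper_mult_left strict_upper_mult_right)
  qed (use c c' in \<open>auto simp: S_def T_def unitriangular_carrier\<close>)
  then show ?thesis by (simp add: bij_betw_same_card S_def T_def)
qed

text \<open>
  Counting pairs \<open>(u, v)\<close> with \<open>u l = l v\<close> by their common value shows that the stabiliser of
  \<open>l\<close> under the two-sided action has \<open>|U l \<inter> l U|\<close> times as many elements as the product of the
  two one-sided stabilisers.
\<close>

lemma card_two_sided_orbit:
  fixes l :: "'k::{field,finite} mat \<Rightarrow> 'k"
  shows "card (left_orbit n l) * card (right_orbit n l) =
         card (left_orbit n l \<inter> right_orbit n l) * card (two_sided_orbit n l)"
proof -
  define U where "U = (unitriangular n :: 'k mat set)"
  define F where "F u = (\<lambda>X\<in>strict_upper n. l (u * X))" for u
  define G where "G v = (\<lambda>X\<in>strict_upper n. l (X * v))" for v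
  define H where "H = (\<lambda>(u, v). \<lambda>X\<in>strict_upper n. l (u * X * v))"
  define SL where "SL = card {u \<in> U. \<forall>X\<in>strict_upper n. l (u * X) = l X}"
  define SR where "SR = card {v \<in> U. \<forall>X\<in>strict_upper n. l (X * v) = l X}"
  define S where "S = {(u, v) \<in> U \<times> U. \<forall>X\<in>strict_upper n. l (u * X * v) = l X}"
  have fin: "finite U" and one: "1\<^sub>m n \<in> U" by (auto simp: U_def)
  have L: "left_orbit n l = F ` U" and R: "right_orbit n l = G ` U"
    and O: "two_sided_orbit n l = H ` (U \<times> U)"
    by (auto simp: left_orbit_def right_orbit_def two_sided_orbit_def F_def G_def H_def U_def)
  have fibL: "card {u \<in> U. F u = F g} = SL" if "g \<in> U" for g
    using card_left_fibre[of g n l] that by (simp add: F_def U_def SL_def restrict_eq_iff)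
  have fibR: "card {u \<in> U. G u = G g} = SR" if "g \<in> U" for g
    using card_right_fibre[of g n l] that by (simp add: G_def U_def SR_def restrict_eq_iff)
  have cL: "card U = SL * card (F ` U)"
    by (rule card_eq_fibre_mult[OF fin fibL])
  have cR: "card U = SR * card (G ` U)"
    by (rule card_eq_fibre_mult[OF fin fibR])
  have "card (U \<times> U) = card S * card (H ` (U \<times> U))"
  proof (rule card_eq_fibre_mult)
    fix g assume "g \<in> U \<times> U"
    then obtain a b where g: "g = (a, b)" "a \<in> unitriangular n" "b \<in> unitriangular n"
      by (auto simp: U_def)
    have "{h \<in> U \<times> U. H h = H g} = {(u, v) \<in> unitriangular n \<times> unitriangular n.
        \<forall>X\<in>strict_upper n. l (u * X * v) = l (a * X * b)}"
      by (auto simp: g(1) H_def U_def restrict_eq_iff)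
    then show "card {h \<in> U \<times> U. H h = H g} = card S"
      using card_two_sided_fibre[OF g(2,3), of l] by (simp add: S_def U_def)
  qed (simp add: fin)
  then have cO: "card U * card U = card S * card (H ` (U \<times> U))"
    by (simp add: card_cartesian_product)
  \<comment> \<open>Inverting \<open>v\<close> turns the condition
    \<open>l (u * X * v) = l X\<close> into \<open>l (u * X) = l (X * v)\<close>, which says that a
    left and a right translate of \<open>l\<close> agree.\<close>
  have "card S = card {(u, v) \<in> U \<times> U. F u = G v}"
  proof -
    \<comment> \<open>The inverse has to be a function of \<open>v\<close> to serve in a bijection;
      as an involution it is its own witness in the converse direction.\<close>
    define rinv where "rinv v = (SOME w. w \<in> U \<and> (\<forall>X\<in>carrier_mat n n. X * v * w = X \<and> X * w * v = X))"
      for v :: "'k mat"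
    have rinv: "rinv v \<in> U" "\<And>X. X \<in> carrier_mat n n \<Longrightarrow> X * v * rinv v = X"
      "\<And>X. X \<in> carrier_mat n n \<Longrightarrow> X * rinv v * v = X" if "v \<in> U" for v
    proof -
      obtain w where "w \<in> unitriangular n" 
        "\<And>X. X \<in> carrier_mat n n \<Longrightarrow> X * v * w = X" "\<And>X. X \<in> carrier_mat n n \<Longrightarrow> X * w * v = X"
        using unitriangular_cancel[of v n] \<open>v \<in> U\<close> unfolding U_def by metis
      then have "\<exists>w. w \<in> U \<and> (\<forall>X\<in>carrier_mat n n. X * v * w = X \<and> X * w * v = X)"
        unfolding U_def by blast
      from someI_ex[OF this] show "rinv v \<in> U" "\<And>X. X \<in> carrier_mat n n \<Longrightarrow> X * v * rinv v = X"
        "\<And>X. X \<in> carrier_mat n n \<Longrightarrow> X * rinv v * v = X"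
        unfolding rinv_def by blast+
    qed
    have rinvinv: "rinv (rinv v) = v" if "v \<in> U" for v
    proof -
      have c: "v \<in> carrier_mat n n" "rinv (rinv v) \<in> carrier_mat n n" 
        using that rinv(1) by (auto simp: U_def unitriangular_carrier)
      have "v * rinv v * rinv (rinv v) = v"
        using rinv(2)[OF rinv(1)[OF that] c(1)] .
      moreover have "v * rinv v = 1\<^sub>m n"
        using rinv(2)[OF that, of "1\<^sub>m n"] c by simp
      ultimately show ?thesis using c by simp
    qed
    have "bij_betw (\<lambda>(u, v). (u, rinv v)) S {(u, v) \<in> U \<times> U. F u = G v}"
    proof (rule bij_betw_byWitness[where f' = "\<lambda>(u, v). (u, rinv v)"])
      show "(\<lambda>(u, v). (u, rinv v)) ` S \<subseteq> {(u, v) \<in> U \<times> U. F u = G v}"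
      proof (clarsimp simp: S_def F_def G_def restrict_eq_iff rinv(1))
        fix u v X :: "'k mat" assume *: "u \<in> U" "v \<in> U" "\<forall>X\<in>strict_upper n. l (u * X * v) = l X"
          and X: "X \<in> strict_upper n"
        have "l (u * (X * rinv v) * v) = l (X * rinv v)"
          using * X rinv(1) by (auto simp: U_def strict_upper_mult_right)
        moreover have "u * (X * rinv v) * v = u * X"
        proof -
          have "u * (X * rinv v) = (u * X) * rinv v"
            using * X rinv(1)[of v] 
            by (simp add: assoc_mult_mat[of _ n n _ n _ n] U_def unitriangular_carrier strict_upper_carrier)
          then show ?thesis
            using rinv(3)[of v "u * X"] * X strict_upper_mult_left[of u n X, THEN strict_upper_carrier] by (simp add: U_def)
        qed
        ultimately show "l (u * X) = l (X * rinv v)" by simp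
      qed
      show "(\<lambda>(u, v). (u, rinv v)) ` {(u, v) \<in> U \<times> U. F u = G v} \<subseteq> S"
      proof (clarsimp simp: S_def F_def G_def restrict_eq_iff rinv(1))
        fix u v X :: "'k mat" assume *: "u \<in> U" "v \<in> U" "\<forall>X\<in>strict_upper n. l (u * X) = l (X * v)"
          and X: "X \<in> strict_upper n"
        have "u * X * rinv v = u * (X * rinv v)"
          using * X rinv(1)[of v]
          by (simp add: assoc_mult_mat[of _ n n _ n _ n] U_def unitriangular_carrier strict_upper_carrier)
        moreover have "l (u * (X * rinv v)) = l (X * rinv v * v)"
          using * X rinv(1)[of v] by (auto simp: U_def strict_upper_mult_right)
        ultimately show "l (u * X * rinv v) = l X"
          using rinv(3)[of v X] * X by (simp add: strict_upper_carrier)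
      qed
    qed (auto simp: S_def rinvinv)
    then show ?thesis by (simp add: bij_betw_same_card)
  qed
  also have "{(u, v) \<in> U \<times> U. F u = G v} =
      (\<Union>x\<in>F ` U \<inter> G ` U. {u \<in> U. F u = x} \<times> {v \<in> U. G v = x})"
    by auto
  also have "card \<dots> = (\<Sum>x\<in>F ` U \<inter> G ` U. card ({u \<in> U. F u = x} \<times> {v \<in> U. G v = x}))"
    by (rule card_UN_disjoint) (use fin in auto)
  also have "\<dots> = (\<Sum>x\<in>F ` U \<inter> G ` U. SL * SR)"
  proof (rule sum.cong[OF refl])
    fix x assume "x \<in> F ` U \<inter> G ` U"
    then obtain a b where "a \<in> U" "b \<in> U" "x = F a" "x = G b" by auto
    then show "card ({u \<in> U. F u = x} \<times> {v \<in> U. G v = x}) = SL * SR"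
      using fibL[of a] fibR[of b] by (simp add: card_cartesian_product)
  qed
  also have "\<dots> = card (F ` U \<inter> G ` U) * (SL * SR)" by simp
  finally have cS: "card S = card (F ` U \<inter> G ` U) * (SL * SR)" .
  have "card U > 0" using fin one card_gt_0_iff by blast
  then have "SL * SR > 0" using cL cR by (metis gr0I mult_is_0)
  \<comment> \<open>Both sides equal the square of \<open>card U\<close>: once by the two one-sided
    counts, once by the two-sided count with the value found for \<open>card S\<close>.\<close>
  moreover have "(SL * SR) * (card (F ` U) * card (G ` U)) =
      (SL * SR) * (card (F ` U \<inter> G ` U) * card (H ` (U \<times> U)))"
  proof -
    have "(SL * SR) * (card (F ` U) * card (G ` U)) = card U * card U"
      by (subst cL, subst cR) (simp only: ac_simps)
    also have "\<dots> = (SL * SR) * (card (F ` U \<inter> G ` U) * card (H ` (U \<times> U)))"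
      by (subst cO, subst cS) (simp only: ac_simps)
    finally show ?thesis .
  qed
  ultimately show ?thesis unfolding L R O by (metis mult_cancel1 less_not_refl)
qed

section \<open>Coordinates of functionals\<close>

definition functional :: "nat \<Rightarrow> (nat \<times> nat \<Rightarrow> 'k) \<Rightarrow> 'k::{field,finite} mat \<Rightarrow> 'k" where
  "functional n m = (\<lambda>X\<in>strict_upper n. \<Sum>(i, j)\<in>pos n. m (i, j) * X $$ (i - 1, j - 1))"

lemma functional_restrict: "functional n (restrict m (pos n)) = functional n m"
  by (auto simp: functional_def restrict_eq_iff intro!: sum.cong)

text \<open>Evaluation at the elementary matrix \<open>E\<close> of a position reads off the
  coordinate there; extensionality settles the values outside \<open>pos n\<close>.\<close>

lemma functional_inj: "inj_on (functional n) (extensional (pos n))"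
proof (rule inj_onI)
  fix m m' :: "nat \<times> nat \<Rightarrow> 'k::{field,finite}"
  assume ext: "m \<in> extensional (pos n)" "m' \<in> extensional (pos n)"
    and eq: "functional n m = functional n m'"
  have "m p = m' p" if p: "p \<in> pos n" for p
  proof -
    define E :: "'k mat" where "E = Matrix.mat n n (\<lambda>(i, j). if (Suc i, Suc j) = p then 1 else 0)"
    have E: "E \<in> strict_upper n"
      using p by (auto simp: E_def strict_upper_def pos_def)
    have "functional n f E = f p" for f
    proof -
      have "functional n f E = (\<Sum>r\<in>pos n. if r = p then f r else 0)"
        using E by (auto simp: functional_def E_def pos_def intro!: sum.cong)
      then show ?thesis using p by simp
    qed
    then show ?thesis using eq by metis
  qed
  then show "m = m'"
    by (rule extensionalityI[OF ext])
qed

text \<open>One shape serves both counts. With \<open>F p = {c p}\<close> it describes the one-sided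
  orbits of a single functional, with \<open>F p\<close> the non-zero scalars it describes
  \<open>J_set\<close>; \<open>S\<close> holds the free positions.\<close>

definition coord_box ::
  "nat \<Rightarrow> nat set set \<Rightarrow> (nat \<times> nat \<Rightarrow> 'k set) \<Rightarrow> (nat \<times> nat) set \<Rightarrow> (nat \<times> nat \<Rightarrow> 'k::{field,finite}) set" where
  "coord_box n \<pi> F S =
     (\<Pi>\<^sub>E p\<in>pos n. if p \<in> arcs \<pi> then F p else if p \<in> S then UNIV else {0})"

lemma card_coord_box:
  fixes F :: "nat \<times> nat \<Rightarrow> 'k::{field,finite} set"
  assumes "arcs \<pi> \<subseteq> pos n" "S \<subseteq> pos n" "arcs \<pi> \<inter> S = {}"
  shows "card (coord_box n \<pi> F S) = (\<Prod>p\<in>arcs \<pi>. card (F p)) * CARD('k) ^ card S"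
proof -
  let ?f = "\<lambda>p. card (if p \<in> arcs \<pi> then F p else if p \<in> S then UNIV else {0})"
  have fin: "finite (arcs \<pi>)" "finite S"
    using assms by (auto intro: finite_subset[OF _ finite_pos])
  have "card (coord_box n \<pi> F S) = (\<Prod>p\<in>pos n. ?f p)"
    by (simp add: coord_box_def card_PiE)
  also have "\<dots> = (\<Prod>p\<in>arcs \<pi> \<union> S. ?f p)"
    by (rule prod.mono_neutral_right) (use assms in auto)
  also have "\<dots> = (\<Prod>p\<in>arcs \<pi>. ?f p) * (\<Prod>p\<in>S. ?f p)"
    by (rule prod.union_disjoint) (use fin assms in auto)
  also have "(\<Prod>p\<in>S. ?f p) = (\<Prod>p\<in>S. CARD('k))"
    by (rule prod.cong) (use assms in auto)
  finally show ?thesis by simp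
qed

lemma coord_box_Int:
  assumes "arcs \<pi> \<inter> S = {}" "arcs \<pi> \<inter> T = {}"
  shows "coord_box n \<pi> F S \<inter> coord_box n \<pi> F T = coord_box n \<pi> F (S \<inter> T)"
  unfolding coord_box_def PiE_Int by (rule PiE_cong) (use assms in auto)

lemma coord_box_extensional: "coord_box n \<pi> F S \<subseteq> extensional (pos n)"
  by (auto simp: coord_box_def PiE_def)

text \<open>Expanding \<open>(u * X)\<close> at an arc \<open>(i, j)\<close> gives the terms
  \<open>u\<close> at \<open>(i, k)\<close> times \<open>X\<close> at \<open>(k, j)\<close>. So the
  coordinate at \<open>(k, j)\<close> collects the arcs ending in \<open>j\<close>; writing it as a
  sum over all arcs avoids asking whether such an arc exists.\<close>

lemma arc_functional_left_mult:
  assumes \<pi>: "partition_on {1..n} \<pi>" and u: "u \<in> unitriangular n"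
  shows "(\<lambda>X\<in>strict_upper n. arc_functional n \<pi> c (u * X)) =
    functional n (\<lambda>(k, j). \<Sum>a\<in>arcs \<pi>. if snd a = j then c a * u $$ (fst a - 1, k - 1) else 0)"
proof -
  have "(\<Sum>(i, j)\<in>arcs \<pi>. c (i, j) * (u * X) $$ (i - 1, j - 1)) =
    (\<Sum>(k, j)\<in>pos n. (\<Sum>a\<in>arcs \<pi>. if snd a = j then c a * u $$ (fst a - 1, k - 1) else 0) *
       X $$ (k - 1, j - 1))" if X: "X \<in> strict_upper n" for X
  proof -
    have inner: "(\<Sum>(k, j)\<in>pos n. if snd a = j then c a * u $$ (fst a - 1, k - 1) * X $$ (k - 1, j - 1) else 0)
        = c a * (u * X) $$ (fst a - 1, snd a - 1)" if "a \<in> arcs \<pi>" for a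
    proof -
      have a: "1 \<le> fst a" "fst a \<le> n" "1 \<le> snd a" "snd a \<le> n"
        using arcs_subset_pos[OF \<pi>] that by (auto simp: pos_def)
      \<comment> \<open>The sum may be extended to the full square, because \<open>X\<close>
        vanishes on and below the diagonal; it then becomes a matrix product entry.\<close>
      have "(\<Sum>(k, j)\<in>pos n. if snd a = j then c a * u $$ (fst a - 1, k - 1) * X $$ (k - 1, j - 1) else 0)
        = (\<Sum>(k, j)\<in>{1..n} \<times> {1..n}. if snd a = j then c a * u $$ (fst a - 1, k - 1) * X $$ (k - 1, j - 1) else 0)"
      proof (rule sum.mono_neutral_left)
        show "\<forall>p\<in>{1..n} \<times> {1..n} - pos n. (case p of (k, j) \<Rightarrow>
            if snd a = j then c a * u $$ (fst a - 1, k - 1) * X $$ (k - 1, j - 1) else 0) = 0"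
        proof clarify
          fix k j assume "(k, j) \<notin> pos n" "k \<in> {1..n}" "j \<in> {1..n}"
          then have "X $$ (k - 1, j - 1) = 0"
            using strict_upper_low[OF X, of j k] by (auto simp: pos_def)
          then show "(if snd a = j then c a * u $$ (fst a - 1, k - 1) * X $$ (k - 1, j - 1) else 0) = 0"
            by simp
        qed
      qed (auto simp: pos_def)
      also have "\<dots> = (\<Sum>k=1..n. c a * (u $$ (fst a - 1, k - 1) * X $$ (k - 1, snd a - 1)))"
        using a by (auto simp: sum.cartesian_product[symmetric] algebra_simps intro!: sum.cong)
      also have "\<dots> = c a * (u * X) $$ (fst a - 1, snd a - 1)"
        using mult_entry[OF unitriangular_carrier[OF u] strict_upper_carrier[OF X] a]
        by (simp add: sum_distrib_left)
      finally show ?thesis .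
    qed
    have "(\<Sum>(k, j)\<in>pos n. (\<Sum>a\<in>arcs \<pi>. if snd a = j then c a * u $$ (fst a - 1, k - 1) else 0) *
       X $$ (k - 1, j - 1)) = (\<Sum>p\<in>pos n. \<Sum>a\<in>arcs \<pi>. case p of (k, j) \<Rightarrow>
         if snd a = j then c a * u $$ (fst a - 1, k - 1) * X $$ (k - 1, j - 1) else 0)"
      by (auto simp: sum_distrib_right intro!: sum.cong)
    also have "\<dots> = (\<Sum>a\<in>arcs \<pi>. c a * (u * X) $$ (fst a - 1, snd a - 1))"
      by (subst sum.swap, rule sum.cong[OF refl], erule inner)
    finally show ?thesis by (simp add: case_prod_unfold)
  qed
  then show ?thesis
    using u by (simp add: functional_def arc_functional_def restrict_eq_iff strict_upper_mult_left)
qed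

text \<open>The mirror image: the coordinate at \<open>(i, l)\<close> collects the arcs starting in
  \<open>i\<close>, weighted by column entries of \<open>v\<close>.\<close>

lemma arc_functional_right_mult:
  assumes \<pi>: "partition_on {1..n} \<pi>" and v: "v \<in> unitriangular n"
  shows "(\<lambda>X\<in>strict_upper n. arc_functional n \<pi> c (X * v)) =
    functional n (\<lambda>(i, l). \<Sum>a\<in>arcs \<pi>. if fst a = i then c a * v $$ (l - 1, snd a - 1) else 0)"
proof -
  have "(\<Sum>(i, j)\<in>arcs \<pi>. c (i, j) * (X * v) $$ (i - 1, j - 1)) =
    (\<Sum>(i, l)\<in>pos n. (\<Sum>a\<in>arcs \<pi>. if fst a = i then c a * v $$ (l - 1, snd a - 1) else 0) *
       X $$ (i - 1, l - 1))" if X: "X \<in> strict_upper n" for X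
  proof -
    have inner: "(\<Sum>(i, l)\<in>pos n. if fst a = i then c a * v $$ (l - 1, snd a - 1) * X $$ (i - 1, l - 1) else 0)
        = c a * (X * v) $$ (fst a - 1, snd a - 1)" if "a \<in> arcs \<pi>" for a
    proof -
      have a: "1 \<le> fst a" "fst a \<le> n" "1 \<le> snd a" "snd a \<le> n"
        using arcs_subset_pos[OF \<pi>] that by (auto simp: pos_def)
      have "(\<Sum>(i, l)\<in>pos n. if fst a = i then c a * v $$ (l - 1, snd a - 1) * X $$ (i - 1, l - 1) else 0)
        = (\<Sum>(i, l)\<in>{1..n} \<times> {1..n}. if fst a = i then c a * v $$ (l - 1, snd a - 1) * X $$ (i - 1, l - 1) else 0)"
      proof (rule sum.mono_neutral_left)
        show "\<forall>p\<in>{1..n} \<times> {1..n} - pos n. (case p of (i, l) \<Rightarrow>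
            if fst a = i then c a * v $$ (l - 1, snd a - 1) * X $$ (i - 1, l - 1) else 0) = 0"
        proof clarify
          fix i l assume "(i, l) \<notin> pos n" "i \<in> {1..n}" "l \<in> {1..n}"
          then have "X $$ (i - 1, l - 1) = 0"
            using strict_upper_low[OF X, of l i] by (auto simp: pos_def)
          then show "(if fst a = i then c a * v $$ (l - 1, snd a - 1) * X $$ (i - 1, l - 1) else 0) = 0"
            by simp
        qed
      qed (auto simp: pos_def)
      also have "\<dots> = (\<Sum>i=1..n. if fst a = i then
          (\<Sum>l=1..n. c a * (X $$ (i - 1, l - 1) * v $$ (l - 1, snd a - 1))) else 0)"
        unfolding sum.cartesian_product[symmetric]
        by (rule sum.cong[OF refl]) (auto simp: mult_ac intro!: sum.cong)
      also have "\<dots> = (\<Sum>l=1..n. c a * (X $$ (fst a - 1, l - 1) * v $$ (l - 1, snd a - 1)))"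
        using a by simp
      also have "\<dots> = c a * (X * v) $$ (fst a - 1, snd a - 1)"
        using mult_entry[OF strict_upper_carrier[OF X] unitriangular_carrier[OF v] a]
        by (simp add: sum_distrib_left)
      finally show ?thesis .
    qed
    have "(\<Sum>(i, l)\<in>pos n. (\<Sum>a\<in>arcs \<pi>. if fst a = i then c a * v $$ (l - 1, snd a - 1) else 0) *
       X $$ (i - 1, l - 1)) = (\<Sum>p\<in>pos n. \<Sum>a\<in>arcs \<pi>. case p of (i, l) \<Rightarrow>
         if fst a = i then c a * v $$ (l - 1, snd a - 1) * X $$ (i - 1, l - 1) else 0)"
      by (auto simp: sum_distrib_right intro!: sum.cong)
    also have "\<dots> = (\<Sum>a\<in>arcs \<pi>. c a * (X * v) $$ (fst a - 1, snd a - 1))"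
      by (subst sum.swap, rule sum.cong[OF refl], erule inner)
    finally show ?thesis by (simp add: case_prod_unfold)
  qed
  then show ?thesis
    using v by (simp add: functional_def arc_functional_def restrict_eq_iff strict_upper_mult_right)
qed

section \<open>One-sided orbits as coordinate boxes\<close>

lemma finite_arcs: "partition_on {1..n} \<pi> \<Longrightarrow> finite (arcs \<pi>)"
  by (rule finite_subset[OF arcs_subset_pos finite_pos])

lemma sum_arcs_into:
  fixes f :: "nat \<times> nat \<Rightarrow> 'a::comm_monoid_add"
  assumes \<pi>: "partition_on {1..n} \<pi>" and ij: "(i, j) \<in> arcs \<pi>"
  shows "(\<Sum>a\<in>arcs \<pi>. if snd a = j then f a else 0) = f (i, j)"
proof -
  have "(\<Sum>a\<in>arcs \<pi>. if snd a = j then f a else 0) = (\<Sum>a\<in>arcs \<pi>. if a = (i, j) then f a else 0)"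
    by (rule sum.cong[OF refl]) (auto dest: arcs_inj[OF \<pi> ij])
  then show ?thesis using finite_arcs[OF \<pi>] ij by simp
qed

lemma sum_arcs_from:
  fixes f :: "nat \<times> nat \<Rightarrow> 'a::comm_monoid_add"
  assumes \<pi>: "partition_on {1..n} \<pi>" and ij: "(i, j) \<in> arcs \<pi>"
  shows "(\<Sum>a\<in>arcs \<pi>. if fst a = i then f a else 0) = f (i, j)"
proof -
  have "(\<Sum>a\<in>arcs \<pi>. if fst a = i then f a else 0) = (\<Sum>a\<in>arcs \<pi>. if a = (i, j) then f a else 0)"
    by (rule sum.cong[OF refl]) (auto dest: arcs_fun[OF \<pi> ij])
  then show ?thesis using finite_arcs[OF \<pi>] ij by simp
qed

text \<open>For an arc \<open>(i, j)\<close> the coordinate at \<open>(k, j)\<close> is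
  \<open>c (i, j)\<close> times the entry of \<open>u\<close> at \<open>(i, k)\<close>: it is 0 for
  \<open>k < i\<close>, equal to \<open>c (i, j)\<close> for \<open>k = i\<close>, and arbitrary for
  \<open>k > i\<close>. Different arcs use different rows of \<open>u\<close>, so these choices are
  independent.\<close>

lemma left_orbit_eq:
  fixes c :: "nat \<times> nat \<Rightarrow> 'k::{field,finite}"
  assumes \<pi>: "partition_on {1..n} \<pi>" and c: "\<forall>a\<in>arcs \<pi>. c a \<noteq> 0"
  shows "left_orbit n (arc_functional n \<pi> c) =
    functional n ` coord_box n \<pi> (\<lambda>p. {c p}) (below_arc n \<pi>)"
proof (intro equalityI subsetI)
  fix f assume "f \<in> left_orbit n (arc_functional n \<pi> c)"
  then obtain u where u: "u \<in> unitriangular n"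
    and f: "f = (\<lambda>X\<in>strict_upper n. arc_functional n \<pi> c (u * X))"
    by (auto simp: left_orbit_def)
  define m where "m = (\<lambda>(k, j). \<Sum>a\<in>arcs \<pi>. if snd a = j then c a * u $$ (fst a - 1, k - 1) else 0)"
  have "restrict m (pos n) \<in> coord_box n \<pi> (\<lambda>p. {c p}) (below_arc n \<pi>)"
  proof -
    have 1: "m (k, j) = c (k, j)" if "(k, j) \<in> arcs \<pi>" for k j
    proof -
      have "1 \<le> k" "k \<le> n" using that arcs_subset_pos[OF \<pi>] by (auto simp: pos_def)
      then show ?thesis
        using sum_arcs_into[OF \<pi> that, of "\<lambda>a. c a * u $$ (fst a - 1, k - 1)"]
          unitriangular_diag[OF u, of k] by (simp add: m_def)
    qed
    have 2: "m (k, j) = 0" if "(k, j) \<in> pos n" "(k, j) \<notin> arcs \<pi>" "(k, j) \<notin> below_arc n \<pi>" for k j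
    proof -
      have "u $$ (i - 1, k - 1) = 0" if ij: "(i, j) \<in> arcs \<pi>" for i
      proof -
        have "k < i"
          using that \<open>(k, j) \<in> pos n\<close> \<open>(k, j) \<notin> arcs \<pi>\<close> \<open>(k, j) \<notin> below_arc n \<pi>\<close>
          by (cases i k rule: linorder_cases) (auto simp: below_arc_def)
        then show ?thesis
          using unitriangular_low[OF u] arcs_subset_pos[OF \<pi>] ij \<open>(k, j) \<in> pos n\<close>
          by (auto simp: pos_def)
      qed
      then show ?thesis unfolding m_def by (auto intro!: sum.neutral)
    qed
    show ?thesis using 1 2 by (auto simp: coord_box_def)
  qed
  then show "f \<in> functional n ` coord_box n \<pi> (\<lambda>p. {c p}) (below_arc n \<pi>)"
    unfolding f arc_functional_left_mult[OF \<pi> u] m_def[symmetric]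
    by (metis functional_restrict imageI)
next
  fix f assume "f \<in> functional n ` coord_box n \<pi> (\<lambda>p. {c p}) (below_arc n \<pi>)"
  then obtain m where f: "f = functional n m"
    and m: "m \<in> coord_box n \<pi> (\<lambda>p. {c p}) (below_arc n \<pi>)" by auto
  \<comment> \<open>For a row \<open>i\<close> in which no arc starts, \<open>nxt i\<close> is an
    unspecified value; such rows of \<open>u\<close> do not enter the sum over arcs.\<close>
  define nxt where "nxt i = (THE j. (i, j) \<in> arcs \<pi>)" for i
  have nxt: "nxt i = j" if "(i, j) \<in> arcs \<pi>" for i j
    unfolding nxt_def using that arcs_fun[OF \<pi>] by blast
  \<comment> \<open>Row \<open>i\<close> of \<open>u\<close> solves
    \<open>c (i, j) * u = m (k, j)\<close> for its arc \<open>(i, j)\<close>. For \<open>k\<close>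
    at or beyond \<open>j\<close> there is no coordinate to match, and the entry is set to
    0.\<close>
  define u where "u = unip n (\<lambda>(i, k). if k < nxt i then m (k, nxt i) / c (i, nxt i) else 0)"
  have u: "u \<in> unitriangular n" by (simp add: u_def)
  have "(\<Sum>a\<in>arcs \<pi>. if snd a = j then c a * u $$ (fst a - 1, k - 1) else 0) = m (k, j)"
    if kj: "(k, j) \<in> pos n" for k j
  proof (cases "\<exists>i. (i, j) \<in> arcs \<pi>")
    case True
    then obtain i where ij: "(i, j) \<in> arcs \<pi>" by blast
    have b: "1 \<le> i" "i \<le> n" "1 \<le> k" "k \<le> n" "k < j"
      using ij kj arcs_subset_pos[OF \<pi>] by (auto simp: pos_def)
    have "c (i, j) * u $$ (i - 1, k - 1) = m (k, j)"
    proof (cases i k rule: linorder_cases)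
      case less
      then show ?thesis using b nxt[OF ij] bspec[OF c ij]
        by (simp add: u_def unip_entry[unfolded One_nat_def])
    next
      case equal
      then have "m (k, j) = c (k, j)" using m ij kj by (auto simp: coord_box_def PiE_iff)
      then show ?thesis using b equal by (simp add: u_def unip_entry[unfolded One_nat_def])
    next
      case greater
      then have "(k, j) \<notin> arcs \<pi>" "(k, j) \<notin> below_arc n \<pi>"
        by (auto simp: below_arc_def dest: arcs_inj[OF \<pi> ij])
      then have "m (k, j) = 0" using m kj by (auto simp: coord_box_def PiE_iff)
      then show ?thesis using b greater by (simp add: u_def unip_entry[unfolded One_nat_def])
    qed
    then show ?thesis
      using sum_arcs_into[OF \<pi> ij, of "\<lambda>a. c a * u $$ (fst a - 1, k - 1)"] by simp
  next
    case False
    then have "(k, j) \<notin> arcs \<pi>" "(k, j) \<notin> below_arc n \<pi>" by (auto simp: below_arc_def)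
    then have "m (k, j) = 0" using m kj by (auto simp: coord_box_def PiE_iff)
    then show ?thesis using False by (auto intro!: sum.neutral)
  qed
  then have "f = (\<lambda>X\<in>strict_upper n. arc_functional n \<pi> c (u * X))"
    unfolding f arc_functional_left_mult[OF \<pi> u]
    by (auto simp: functional_def restrict_eq_iff intro!: sum.cong)
  then show "f \<in> left_orbit n (arc_functional n \<pi> c)"
    using u by (auto simp: left_orbit_def)
qed

text \<open>The same argument with columns: each arc \<open>(i, j)\<close> controls column
  \<open>j\<close> of \<open>v\<close>, and the entries at \<open>(l, j)\<close> with
  \<open>i < l < j\<close> are the free coordinates to the left of the arc.\<close>

lemma right_orbit_eq:
  fixes c :: "nat \<times> nat \<Rightarrow> 'k::{field,finite}"
  assumes \<pi>: "partition_on {1..n} \<pi>" and c: "\<forall>a\<in>arcs \<pi>. c a \<noteq> 0"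
  shows "right_orbit n (arc_functional n \<pi> c) =
    functional n ` coord_box n \<pi> (\<lambda>p. {c p}) (left_of_arc n \<pi>)"
proof (intro equalityI subsetI)
  fix f assume "f \<in> right_orbit n (arc_functional n \<pi> c)"
  then obtain v where v: "v \<in> unitriangular n"
    and f: "f = (\<lambda>X\<in>strict_upper n. arc_functional n \<pi> c (X * v))"
    by (auto simp: right_orbit_def)
  define m where "m = (\<lambda>(i, l). \<Sum>a\<in>arcs \<pi>. if fst a = i then c a * v $$ (l - 1, snd a - 1) else 0)"
  have "restrict m (pos n) \<in> coord_box n \<pi> (\<lambda>p. {c p}) (left_of_arc n \<pi>)"
  proof -
    have 1: "m (i, l) = c (i, l)" if "(i, l) \<in> arcs \<pi>" for i l
    proof -
      have "1 \<le> l" "l \<le> n" using that arcs_subset_pos[OF \<pi>] by (auto simp: pos_def)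
      then show ?thesis
        using sum_arcs_from[OF \<pi> that, of "\<lambda>a. c a * v $$ (l - 1, snd a - 1)"]
          unitriangular_diag[OF v, of l] by (simp add: m_def)
    qed
    have 2: "m (i, l) = 0" if "(i, l) \<in> pos n" "(i, l) \<notin> arcs \<pi>" "(i, l) \<notin> left_of_arc n \<pi>" for i l
    proof -
      have "v $$ (l - 1, j - 1) = 0" if ij: "(i, j) \<in> arcs \<pi>" for j
      proof -
        have "j < l"
          using that \<open>(i, l) \<in> pos n\<close> \<open>(i, l) \<notin> arcs \<pi>\<close> \<open>(i, l) \<notin> left_of_arc n \<pi>\<close>
          by (cases l j rule: linorder_cases) (auto simp: left_of_arc_def)
        then show ?thesis
          using unitriangular_low[OF v] arcs_subset_pos[OF \<pi>] ij \<open>(i, l) \<in> pos n\<close>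
          by (auto simp: pos_def)
      qed
      then show ?thesis unfolding m_def by (auto intro!: sum.neutral)
    qed
    show ?thesis using 1 2 by (auto simp: coord_box_def)
  qed
  then show "f \<in> functional n ` coord_box n \<pi> (\<lambda>p. {c p}) (left_of_arc n \<pi>)"
    unfolding f arc_functional_right_mult[OF \<pi> v] m_def[symmetric]
    by (metis functional_restrict imageI)
next
  fix f assume "f \<in> functional n ` coord_box n \<pi> (\<lambda>p. {c p}) (left_of_arc n \<pi>)"
  then obtain m where f: "f = functional n m"
    and m: "m \<in> coord_box n \<pi> (\<lambda>p. {c p}) (left_of_arc n \<pi>)" by auto
  define prv where "prv j = (THE i. (i, j) \<in> arcs \<pi>)" for j
  have prv: "prv j = i" if "(i, j) \<in> arcs \<pi>" for i j
    unfolding prv_def using that arcs_inj[OF \<pi>] by blast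
  define v where "v = unip n (\<lambda>(l, j). if prv j < l then m (prv j, l) / c (prv j, j) else 0)"
  have v: "v \<in> unitriangular n" by (simp add: v_def)
  have "(\<Sum>a\<in>arcs \<pi>. if fst a = i then c a * v $$ (l - 1, snd a - 1) else 0) = m (i, l)"
    if il: "(i, l) \<in> pos n" for i l
  proof (cases "\<exists>j. (i, j) \<in> arcs \<pi>")
    case True
    then obtain j where ij: "(i, j) \<in> arcs \<pi>" by blast
    have b: "1 \<le> j" "j \<le> n" "1 \<le> l" "l \<le> n" "i < l"
      using ij il arcs_subset_pos[OF \<pi>] by (auto simp: pos_def)
    have "c (i, j) * v $$ (l - 1, j - 1) = m (i, l)"
    proof (cases l j rule: linorder_cases)
      case less
      then show ?thesis using b prv[OF ij] bspec[OF c ij]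
        by (simp add: v_def unip_entry[unfolded One_nat_def])
    next
      case equal
      then have "m (i, l) = c (i, l)" using m ij il by (auto simp: coord_box_def PiE_iff)
      then show ?thesis using b equal by (simp add: v_def unip_entry[unfolded One_nat_def])
    next
      case greater
      then have "(i, l) \<notin> arcs \<pi>" "(i, l) \<notin> left_of_arc n \<pi>"
        by (auto simp: left_of_arc_def dest: arcs_fun[OF \<pi> ij])
      then have "m (i, l) = 0" using m il by (auto simp: coord_box_def PiE_iff)
      then show ?thesis using b greater by (simp add: v_def unip_entry[unfolded One_nat_def])
    qed
    then show ?thesis
      using sum_arcs_from[OF \<pi> ij, of "\<lambda>a. c a * v $$ (l - 1, snd a - 1)"] by simp
  next
    case False
    then have "(i, l) \<notin> arcs \<pi>" "(i, l) \<notin> left_of_arc n \<pi>" by (auto simp: left_of_arc_def)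
    then have "m (i, l) = 0" using m il by (auto simp: coord_box_def PiE_iff)
    then show ?thesis using False by (auto intro!: sum.neutral)
  qed
  then have "f = (\<lambda>X\<in>strict_upper n. arc_functional n \<pi> c (X * v))"
    unfolding f arc_functional_right_mult[OF \<pi> v]
    by (auto simp: functional_def restrict_eq_iff intro!: sum.cong)
  then show "f \<in> right_orbit n (arc_functional n \<pi> c)"
    using v by (auto simp: right_orbit_def)
qed

section \<open>Sizes and disjointness of the two-sided orbits\<close>

lemma below_arc_subset: "below_arc n \<pi> \<subseteq> pos n"
  and left_of_arc_subset: "left_of_arc n \<pi> \<subseteq> pos n"
  by (auto simp: below_arc_def left_of_arc_def)

text \<open>The one-sided orbits and their intersection are boxes, so the orbit identity compares
  powers of \<open>q\<close>; inclusion-exclusion turns the exponents of the two kinds and their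
  overlap into that of the union. The left orbit is recorded because it enters the normalising
  factor of the supercharacter.\<close>

lemma card_two_sided_orbit_arc_functional:
  fixes c :: "nat \<times> nat \<Rightarrow> 'k::{field,finite}"
  assumes \<pi>: "partition_on {1..n} \<pi>" and c: "\<forall>a\<in>arcs \<pi>. c a \<noteq> 0"
  shows "card (left_orbit n (arc_functional n \<pi> c)) = CARD('k) ^ card (below_arc n \<pi>)"
    and "card (two_sided_orbit n (arc_functional n \<pi> c)) =
      CARD('k) ^ card (below_arc n \<pi> \<union> left_of_arc n \<pi>)"
proof -
  let ?A = "below_arc n \<pi>" and ?B = "left_of_arc n \<pi>" and ?l = "arc_functional n \<pi> c"
  let ?box = "coord_box n \<pi> (\<lambda>p. {c p})"
  have disj: "arcs \<pi> \<inter> ?A = {}" "arcs \<pi> \<inter> ?B = {}"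
    using arcs_disjoint_singular[OF \<pi>] by auto
  have card_img: "card (functional n ` ?box S) = CARD('k) ^ card S"
    if "S \<subseteq> pos n" "arcs \<pi> \<inter> S = {}" for S
  proof -
    have "card (functional n ` ?box S) = card (?box S)"
      by (rule card_image) (rule inj_on_subset[OF functional_inj coord_box_extensional])
    then show ?thesis
      using card_coord_box[OF arcs_subset_pos[OF \<pi>] that, of "\<lambda>p. {c p}"] by simp
  qed
  show L: "card (left_orbit n ?l) = CARD('k) ^ card ?A"
    unfolding left_orbit_eq[OF \<pi> c] by (rule card_img[OF below_arc_subset disj(1)])
  have R: "card (right_orbit n ?l) = CARD('k) ^ card ?B"
    unfolding right_orbit_eq[OF \<pi> c] by (rule card_img[OF left_of_arc_subset disj(2)])
  have "left_orbit n ?l \<inter> right_orbit n ?l = functional n ` (?box ?A \<inter> ?box ?B)"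
    unfolding left_orbit_eq[OF \<pi> c] right_orbit_eq[OF \<pi> c]
    by (rule inj_on_image_Int[OF functional_inj coord_box_extensional coord_box_extensional, symmetric])
  also have "\<dots> = functional n ` ?box (?A \<inter> ?B)"
    by (simp only: coord_box_Int[OF disj])
  also have "card \<dots> = CARD('k) ^ card (?A \<inter> ?B)"
    by (rule card_img) (use below_arc_subset disj in auto)
  finally have I: "card (left_orbit n ?l \<inter> right_orbit n ?l) = CARD('k) ^ card (?A \<inter> ?B)" .
  have fin: "finite ?A" "finite ?B"
    using finite_subset[OF below_arc_subset finite_pos] finite_subset[OF left_of_arc_subset finite_pos]
    by blast+
  have "CARD('k) ^ card (?A \<inter> ?B) * card (two_sided_orbit n ?l) =
      CARD('k) ^ (card ?A + card ?B)"
    using card_two_sided_orbit[of n ?l] by (simp add: L R I power_add)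
  also have "\<dots> = CARD('k) ^ card (?A \<inter> ?B) * CARD('k) ^ card (?A \<union> ?B)"
    by (simp add: card_Un_Int[OF fin] power_add mult.commute)
  finally show "card (two_sided_orbit n ?l) = CARD('k) ^ card (?A \<union> ?B)"
    by simp
qed

text \<open>A common element, after moving group elements across, makes the left orbit of one
  functional meet the right orbit of the other. All points of these boxes have the coordinates
  \<open>c\<close> and \<open>c'\<close>, respectively, at the arcs.\<close>

lemma two_sided_orbit_disjoint:
  fixes c c' :: "nat \<times> nat \<Rightarrow> 'k::{field,finite}"
  assumes \<pi>: "partition_on {1..n} \<pi>"
    and c: "c \<in> arcs \<pi> \<rightarrow>\<^sub>E (UNIV - {0})" and c': "c' \<in> arcs \<pi> \<rightarrow>\<^sub>E (UNIV - {0})"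
    and meet: "two_sided_orbit n (arc_functional n \<pi> c) \<inter> two_sided_orbit n (arc_functional n \<pi> c') \<noteq> {}"
  shows "c = c'"
proof -
  let ?l = "arc_functional n \<pi> c" and ?l' = "arc_functional n \<pi> c'"
  obtain u v u' v' where U: "u \<in> unitriangular n" "v \<in> unitriangular n"
      "u' \<in> unitriangular n" "v' \<in> unitriangular n"
    and eq: "\<And>X. X \<in> strict_upper n \<Longrightarrow> ?l (u * X * v) = ?l' (u' * X * v')"
    using meet by (force simp: two_sided_orbit_def restrict_eq_iff)
  obtain h where h: "h \<in> unitriangular n" "u' * h = 1\<^sub>m n"
    using unitriangular_inverse[OF U(3)] by blast
  obtain k where k: "k \<in> unitriangular n" "k * v = 1\<^sub>m n"
    using unitriangular_inverse[OF U(2)] by blast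
  have "?l (u * h * X) = ?l' (X * (k * v'))" if X: "X \<in> strict_upper n" for X
  proof -
    \<comment> \<open>Evaluating at \<open>h * X * k\<close>, with \<open>h\<close> inverse to
      \<open>u'\<close> and \<open>k\<close> inverse to \<open>v\<close>, clears \<open>v\<close>
      from one side of the equation and \<open>u'\<close> from the other.\<close>
    have hXk: "h * X * k \<in> strict_upper n"
      using X h k by (simp add: strict_upper_mult_left strict_upper_mult_right)
    have car: "u * h * X \<in> carrier_mat n n" "X * (k * v') \<in> carrier_mat n n"
      "u' * h * X = X"
      using X U h k
      by (auto simp: strict_upper_mult_left strict_upper_mult_right unitriangular_mult
          intro!: strict_upper_carrier left_mult_one_mat)
    have "u * h * X = u * (h * X * k) * v"
      using two_sided_assoc[OF U(1) h(1) k(1) U(2) X] k right_mult_one_mat[OF car(1)] by simp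
    moreover have "X * (k * v') = u' * (h * X * k) * v'"
      using two_sided_assoc[OF U(3) h(1) k(1) U(4) X] h car(3) by simp
    ultimately show ?thesis using eq[OF hXk] by simp
  qed
  then have "(\<lambda>X\<in>strict_upper n. ?l (u * h * X)) = (\<lambda>X\<in>strict_upper n. ?l' (X * (k * v')))"
    by (simp add: restrict_eq_iff)
  then have ne: "left_orbit n ?l \<inter> right_orbit n ?l' \<noteq> {}"
    using unitriangular_mult[OF U(1) h(1)] unitriangular_mult[OF k(1) U(4)]
    unfolding left_orbit_def right_orbit_def by blast
  have nz: "\<forall>a\<in>arcs \<pi>. c a \<noteq> 0" "\<forall>a\<in>arcs \<pi>. c' a \<noteq> 0"
    using c c' by (auto simp: PiE_iff)
  obtain m m' where m: "m \<in> coord_box n \<pi> (\<lambda>p. {c p}) (below_arc n \<pi>)"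
    "m' \<in> coord_box n \<pi> (\<lambda>p. {c' p}) (left_of_arc n \<pi>)" "functional n m = functional n m'"
    using ne unfolding left_orbit_eq[OF \<pi> nz(1)] right_orbit_eq[OF \<pi> nz(2)] by blast
  then have "m = m'"
    using inj_onD[OF functional_inj] coord_box_extensional by blast
  then have "c a = c' a" if "a \<in> arcs \<pi>" for a
    using m that arcs_subset_pos[OF \<pi>] by (force simp: coord_box_def PiE_iff)
  then show ?thesis using c c' by (rule PiE_ext[rotated 2])
qed

section \<open>Characters of the space of strictly upper triangular matrices\<close>

text \<open>The maximum \<open>M\<close> of the norms is attained at some \<open>y\<close>; doubling
  \<open>y\<close> gives \<open>M * M \<le> M\<close>, so no norm exceeds 1. Since the values at
  \<open>x\<close> and \<open>- x\<close> multiply to 1, both have norm 1.\<close>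

lemma nontrivial_additive_character_norm:
  assumes \<theta>: "nontrivial_additive_character \<theta>"
  shows "norm (\<theta> x) = 1"
proof -
  have 0: "\<theta> 0 = 1" and add: "\<And>x y. \<theta> (x + y) = \<theta> x * \<theta> y"
    using \<theta> by (auto simp: nontrivial_additive_character_def)
  define M where "M = Max (range (\<lambda>x. norm (\<theta> x)))"
  have le_M: "norm (\<theta> x) \<le> M" for x unfolding M_def by (rule Max_ge) auto
  have "M \<in> range (\<lambda>x. norm (\<theta> x))" unfolding M_def by (rule Max_in) auto
  then obtain y where y: "M = norm (\<theta> y)" by auto
  have "M * M \<le> M" using le_M[of "y + y"] by (simp only: add norm_mult y)
  then have "M \<le> 1"
    using mult_strict_right_mono[of 1 M M] by (cases "M \<le> 1") auto
  then have le: "norm (\<theta> x) \<le> 1" for x using le_M[of x] by linarith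
  have "norm (\<theta> x) * norm (\<theta> (- x)) = 1"
    using add[of x "- x"] 0 by (simp flip: norm_mult)
  then show ?thesis
    using le[of x] le[of "- x"] by (smt (verit) mult_left_le norm_ge_zero)
qed

lemma nontrivial_additive_character_cnj:
  assumes \<theta>: "nontrivial_additive_character \<theta>"
  shows "cnj (\<theta> x) = \<theta> (- x)"
proof -
  have "\<theta> x * \<theta> (- x) = 1"
    using \<theta> unfolding nontrivial_additive_character_def by (metis add.right_inverse)
  moreover have "\<theta> x * cnj (\<theta> x) = 1"
    using nontrivial_additive_character_norm[OF \<theta>, of x]
    by (simp add: complex_norm_square[symmetric])
  moreover have "\<theta> x \<noteq> 0"
    using nontrivial_additive_character_norm[OF \<theta>, of x] by auto
  ultimately show ?thesis by (metis mult_left_cancel)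
qed

section \<open>Linear functionals and orthogonality of their characters\<close>

definition strict_upper_linear :: "nat \<Rightarrow> ('k::{field,finite} mat \<Rightarrow> 'k) \<Rightarrow> bool" where
  "strict_upper_linear n \<mu> \<longleftrightarrow> \<mu> \<in> extensional (strict_upper n) \<and>
     (\<forall>X\<in>strict_upper n. \<forall>Y\<in>strict_upper n. \<mu> (X + Y) = \<mu> X + \<mu> Y) \<and>
     (\<forall>a. \<forall>X\<in>strict_upper n. \<mu> (a \<cdot>\<^sub>m X) = a * \<mu> X)"

lemma strict_upper_add: "X \<in> strict_upper n \<Longrightarrow> Y \<in> strict_upper n \<Longrightarrow> X + Y \<in> strict_upper n"
  by (auto simp: strict_upper_def)

lemma strict_upper_smult: "X \<in> strict_upper n \<Longrightarrow> a \<cdot>\<^sub>m X \<in> strict_upper n"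
  by (auto simp: strict_upper_def)

lemma strict_upper_zero: "0\<^sub>m n n \<in> strict_upper n"
  by (auto simp: strict_upper_def)

lemma two_sided_orbit_linear:
  assumes \<pi>: "partition_on {1..n} \<pi>"
    and \<mu>: "\<mu> \<in> two_sided_orbit n (arc_functional n \<pi> c)"
  shows "strict_upper_linear n \<mu>"
proof -
  obtain u v where uv: "u \<in> unitriangular n" "v \<in> unitriangular n"
    and \<mu>: "\<mu> = (\<lambda>X\<in>strict_upper n. arc_functional n \<pi> c (u * X * v))"
    using \<mu> by (auto simp: two_sided_orbit_def)
  note car = unitriangular_carrier[OF uv(1)] unitriangular_carrier[OF uv(2)]
  have pos: "i - 1 < n" "j - 1 < n" if "(i, j) \<in> arcs \<pi>" for i j
    using arcs_subset_pos[OF \<pi>] that by (auto simp: pos_def)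
  have add: "arc_functional n \<pi> c (X + Y) = arc_functional n \<pi> c X + arc_functional n \<pi> c Y"
    if X: "X \<in> strict_upper n" and Y: "Y \<in> strict_upper n" for X Y
  proof -
    have "arc_functional n \<pi> c (X + Y) =
        (\<Sum>(i, j)\<in>arcs \<pi>. c (i, j) * X $$ (i - 1, j - 1) + c (i, j) * Y $$ (i - 1, j - 1))"
      using X Y pos strict_upper_carrier[OF X] strict_upper_carrier[OF Y]
      by (auto simp: arc_functional_def strict_upper_add distrib_left intro!: sum.cong)
    then show ?thesis
      using X Y by (simp add: arc_functional_def sum.distrib case_prod_unfold)
  qed
  have smult: "arc_functional n \<pi> c (a \<cdot>\<^sub>m X) = a * arc_functional n \<pi> c X"
    if X: "X \<in> strict_upper n" for a X
    using X pos strict_upper_carrier[OF X]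
    by (auto simp: arc_functional_def strict_upper_smult sum_distrib_left intro!: sum.cong)
  have mem: "u * X * v \<in> strict_upper n" if "X \<in> strict_upper n" for X
    using that uv by (simp add: strict_upper_mult_left strict_upper_mult_right)
  have "u * (X + Y) * v = u * X * v + u * Y * v"
    if "X \<in> strict_upper n" "Y \<in> strict_upper n" for X Y
    using that[THEN strict_upper_carrier] car
    by (simp add: mult_add_distrib_mat[of u n n] add_mult_distrib_mat[of _ n n _ v n])
  moreover have "u * (a \<cdot>\<^sub>m X) * v = a \<cdot>\<^sub>m (u * X * v)" if "X \<in> strict_upper n" for a X
    using that[THEN strict_upper_carrier] car
    by (simp add: mult_smult_distrib[of u n n X n] mult_smult_assoc_mat[of "u * X" n n v n])
  ultimately show ?thesis
    by (simp add: strict_upper_linear_def \<mu> strict_upper_add strict_upper_smult add smult mem)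
qed

lemma unitriangular_minus_one:
  assumes "u \<in> unitriangular n"
  shows "u - 1\<^sub>m n \<in> strict_upper n"
  using assms by (auto simp: unitriangular_def strict_upper_def upper_triangular_def le_less)

lemma unitriangular_add_strict_upper:
  assumes "u \<in> unitriangular n" "Y \<in> strict_upper n"
  shows "u + Y \<in> unitriangular n"
  using assms by (auto simp: unitriangular_def strict_upper_def upper_triangular_def)

text \<open>Subtracting the identity maps the unitriangular matrices onto an additive group, on
  which the summand is the character \<theta> of \<mu> - \<nu>. If this character takes a value
  other than 1 at \<open>Y\<close>, translation by \<open>Y\<close> multiplies the sum by that
  value, so the sum is 0.\<close>

lemma character_orthogonality:
  fixes \<theta> :: "'k::{field,finite} \<Rightarrow> complex"
  assumes \<theta>: "nontrivial_additive_character \<theta>"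
    and \<mu>: "strict_upper_linear n \<mu>" and \<nu>: "strict_upper_linear n \<nu>"
  shows "(\<Sum>u\<in>unitriangular n. \<theta> (\<mu> (u - 1\<^sub>m n)) * cnj (\<theta> (\<nu> (u - 1\<^sub>m n)))) =
    (if \<mu> = \<nu> then of_nat (card (unitriangular n :: 'k mat set)) else 0)"
proof -
  have add: "\<theta> (x + y) = \<theta> x * \<theta> y" for x y
    using \<theta> by (auto simp: nontrivial_additive_character_def)
  have \<theta>0: "\<theta> 0 = 1" using \<theta> by (auto simp: nontrivial_additive_character_def)
  define f where "f X = \<theta> (\<mu> X - \<nu> X)" for X
  have f: "\<theta> (\<mu> X) * cnj (\<theta> (\<nu> X)) = f X" for X
    by (simp add: f_def nontrivial_additive_character_cnj[OF \<theta>] flip: add)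
  show ?thesis
  proof (cases "\<mu> = \<nu>")
    case True
    then have "\<theta> (\<nu> X) * cnj (\<theta> (\<nu> X)) = 1" for X
      using f[of X] by (simp add: f_def \<theta>0)
    then show ?thesis using True by simp
  next
    case False
    \<comment> \<open>Both maps are extensional, so they must differ at a strictly upper
      matrix.\<close>
    have "\<exists>X\<in>strict_upper n. \<mu> X \<noteq> \<nu> X"
      using False \<mu> \<nu> unfolding strict_upper_linear_def by (metis extensionalityI)
    then obtain X where X: "X \<in> strict_upper n" "\<mu> X \<noteq> \<nu> X" by blast
    obtain x where x: "\<theta> x \<noteq> 1"
      using \<theta> by (auto simp: nontrivial_additive_character_def)
    \<comment> \<open>A non-zero value of \<mu> - \<nu> may still lie in the kernel of \<theta>;
      scaling \<open>X\<close> moves the value to \<open>x\<close>, where \<theta> is not 1.\<close>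
    define Y where "Y = (x / (\<mu> X - \<nu> X)) \<cdot>\<^sub>m X"
    have Y: "Y \<in> strict_upper n" using X by (simp add: Y_def strict_upper_smult)
    have "\<mu> Y - \<nu> Y = x / (\<mu> X - \<nu> X) * (\<mu> X - \<nu> X)"
      using X(1) \<mu> \<nu> by (simp only: Y_def strict_upper_linear_def right_diff_distrib)
    then have "\<mu> Y - \<nu> Y = x" using X(2) by simp
    then have fY: "f Y \<noteq> 1" using x by (simp add: f_def)
    have shift: "f (u + Y - 1\<^sub>m n) = f Y * f (u - 1\<^sub>m n)" if u: "u \<in> unitriangular n" for u
    proof -
      have "u + Y - 1\<^sub>m n = (u - 1\<^sub>m n) + Y"
        using unitriangular_carrier[OF u] strict_upper_carrier[OF Y] by (auto intro!: eq_matI)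
      then show ?thesis
        using \<mu> \<nu> Y unitriangular_minus_one[OF u]
        by (simp add: f_def strict_upper_linear_def algebra_simps flip: add)
    qed
    have inj: "inj_on (\<lambda>u. u + Y) (unitriangular n)"
    proof (rule inj_onI)
      fix u u' assume u: "u \<in> unitriangular n" "u' \<in> unitriangular n" and eq: "u + Y = u' + Y"
      have "(u + Y) - Y = u" "(u' + Y) - Y = u'"
        using u[THEN unitriangular_carrier] strict_upper_carrier[OF Y] by (auto intro!: eq_matI)
      then show "u = u'" using eq by metis
    qed
    have "(\<lambda>u. u + Y) ` unitriangular n = unitriangular n"
      by (rule endo_inj_surj) (use inj Y in \<open>auto simp: unitriangular_add_strict_upper\<close>)
    then have "(\<Sum>u\<in>unitriangular n. f (u - 1\<^sub>m n)) = (\<Sum>u\<in>unitriangular n. f (u + Y - 1\<^sub>m n))"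
      using sum.reindex[OF inj, of "\<lambda>u. f (u - 1\<^sub>m n)"] by simp
    also have "\<dots> = f Y * (\<Sum>u\<in>unitriangular n. f (u - 1\<^sub>m n))"
      by (simp add: shift sum_distrib_left)
    finally have "(\<Sum>u\<in>unitriangular n. f (u - 1\<^sub>m n)) = 0" using fY by simp
    then show ?thesis using False by (simp add: f)
  qed
qed

section \<open>The superplancherel measure\<close>

text \<open>In coordinates \<open>J_set\<close> is a box with non-zero scalars at the arcs, free
  entries at the singular positions and zeros elsewhere. Its exponent of \<open>q\<close> is that of
  each two-sided orbit.\<close>

lemma card_J_set:
  assumes \<pi>: "partition_on {1..n} \<pi>"
  shows "card (J_set n \<pi> :: 'k::{field,finite} mat set) =
    (CARD('k) - 1) ^ card (arcs \<pi>) * CARD('k) ^ card (below_arc n \<pi> \<union> left_of_arc n \<pi>)"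
proof -
  let ?S = "below_arc n \<pi> \<union> left_of_arc n \<pi>"
  let ?box = "coord_box n \<pi> (\<lambda>_. UNIV - {0 :: 'k}) ?S"
  have disj: "arcs \<pi> \<inter> ?S = {}" by (rule arcs_disjoint_singular[OF \<pi>])
  have sub: "arcs \<pi> \<subseteq> pos n" by (rule arcs_subset_pos[OF \<pi>])
  have ent: "unip n m $$ (i - 1, j - 1) = m (i, j)" if "(i, j) \<in> pos n" for i j and m :: "nat \<times> nat \<Rightarrow> 'k"
    using that unip_entry[of i n j m] by (auto simp: pos_def)
  have "bij_betw (unip n) ?box (J_set n \<pi>)"
  proof (rule bij_betw_byWitness[where f' = "\<lambda>A. \<lambda>(i, j)\<in>pos n. A $$ (i - 1, j - 1)"])
    show "\<forall>m\<in>?box. (\<lambda>(i, j)\<in>pos n. unip n m $$ (i - 1, j - 1)) = m"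
      using restrict_unip coord_box_extensional by blast
    show "\<forall>A\<in>J_set n \<pi>. unip n (\<lambda>(i, j)\<in>pos n. A $$ (i - 1, j - 1)) = A"
      using unip_restrict by (auto simp: J_set_def)
    show "unip n ` ?box \<subseteq> J_set n \<pi>"
    proof clarify
      fix m assume m: "m \<in> ?box"
      note mem = PiE_mem[OF m[unfolded coord_box_def]]
      have "unip n m $$ (i - 1, j - 1) \<noteq> 0" if "(i, j) \<in> arcs \<pi>" for i j
      proof -
        have "(i, j) \<in> pos n" using that sub by blast
        then show ?thesis using mem[of "(i, j)"] that ent[of i j m] by simp
      qed
      moreover have "unip n m $$ (i - 1, j - 1) = 0" if "(i, j) \<in> Reg n \<pi> - arcs \<pi>" for i j
      proof -
        have "(i, j) \<in> pos n" using that by (auto simp: Reg_eq)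
        then show ?thesis using mem[of "(i, j)"] that ent[of i j m] by (simp add: Reg_eq)
      qed
      ultimately show "unip n m \<in> J_set n \<pi>" by (auto simp: J_set_def)
    qed
    show "(\<lambda>A. \<lambda>(i, j)\<in>pos n. A $$ (i - 1, j - 1)) ` J_set n \<pi> \<subseteq> ?box"
      using disj by (fastforce simp: J_set_def Reg_eq coord_box_def)
  qed
  then have "card (J_set n \<pi> :: 'k mat set) = card ?box"
    by (simp add: bij_betw_same_card)
  also have "\<dots> = (\<Prod>p\<in>arcs \<pi>. card (UNIV - {0 :: 'k})) * CARD('k) ^ card ?S"
    by (rule card_coord_box) (use sub disj below_arc_subset left_of_arc_subset in auto)
  finally show ?thesis by (simp add: card_Diff_singleton)
qed

lemma SPl_eq_card_J_set:
  fixes \<theta> :: "'k::{field,finite} \<Rightarrow> complex"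
  assumes \<theta>: "nontrivial_additive_character \<theta>" and \<pi>: "partition_on {1..n} \<pi>"
  shows "SPl \<theta> n \<pi> =
    of_nat (card (J_set n \<pi> :: 'k mat set)) / of_nat (card (unitriangular n :: 'k mat set))"
proof -
  let ?U = "unitriangular n :: 'k mat set"
  define C where "C = (arcs \<pi> \<rightarrow>\<^sub>E (UNIV - {0 :: 'k}))"
  define Orb where "Orb c = two_sided_orbit n (arc_functional n \<pi> c)" for c :: "nat \<times> nat \<Rightarrow> 'k"
  define W where "W = (\<Union>c\<in>C. Orb c)"
  \<comment> \<open>The quotient of left and two-sided orbit sizes depends on the arcs alone, so it
    can be pulled out of the sum over \<open>c\<close>.\<close>
  define k :: complex where "k = of_nat (CARD('k) ^ card (below_arc n \<pi>)) /
    of_nat (CARD('k) ^ card (below_arc n \<pi> \<union> left_of_arc n \<pi>))"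
  have k: "k \<noteq> 0" by (simp add: k_def)
  have finC: "finite C" unfolding C_def using finite_arcs[OF \<pi>] by (simp add: finite_PiE)
  have nz: "\<forall>a\<in>arcs \<pi>. c a \<noteq> 0" if "c \<in> C" for c
    using that by (auto simp: C_def PiE_iff)
  have card_Orb: "card (Orb c) = CARD('k) ^ card (below_arc n \<pi> \<union> left_of_arc n \<pi>)"
    if "c \<in> C" for c
    unfolding Orb_def by (rule card_two_sided_orbit_arc_functional(2)[OF \<pi> nz[OF that]])
  \<comment> \<open>An infinite set would have cardinality 0, whereas a power of \<open>q\<close> is
    positive.\<close>
  have finO: "finite (Orb c)" if "c \<in> C" for c
    by (rule card_ge_0_finite) (simp add: card_Orb[OF that])
  have disj: "\<forall>c\<in>C. \<forall>c'\<in>C. c \<noteq> c' \<longrightarrow> Orb c \<inter> Orb c' = {}"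
    using two_sided_orbit_disjoint[OF \<pi>] unfolding C_def Orb_def by blast
  have finW: "finite W" using finC finO by (simp add: W_def)
  have "card W = (\<Sum>c\<in>C. card (Orb c))"
    unfolding W_def by (rule card_UN_disjoint) (use finC finO disj in auto)
  also have "\<dots> = card C * CARD('k) ^ card (below_arc n \<pi> \<union> left_of_arc n \<pi>)"
    by (simp add: card_Orb)
  also have "card C = (CARD('k) - 1) ^ card (arcs \<pi>)"
    unfolding C_def using finite_arcs[OF \<pi>] by (simp add: card_PiE card_Diff_singleton)
  finally have cardW: "card W = card (J_set n \<pi> :: 'k mat set)"
    by (simp add: card_J_set[OF \<pi>])
  have chi: "supercharacter \<theta> n \<pi> u = k * (\<Sum>m\<in>W. \<theta> (m (u - 1\<^sub>m n)))" for u
  proof -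
    have "supercharacter \<theta> n \<pi> u = (\<Sum>c\<in>C. k * (\<Sum>m\<in>Orb c. \<theta> (m (u - 1\<^sub>m n))))"
      unfolding supercharacter_def functional_supercharacter_def C_def[symmetric]
      by (rule sum.cong[OF refl])
        (use card_Orb card_two_sided_orbit_arc_functional(1)[OF \<pi> nz] in \<open>simp add: Orb_def k_def\<close>)
    also have "\<dots> = k * (\<Sum>c\<in>C. \<Sum>m\<in>Orb c. \<theta> (m (u - 1\<^sub>m n)))"
      by (simp add: sum_distrib_left)
    also have "(\<Sum>c\<in>C. \<Sum>m\<in>Orb c. \<theta> (m (u - 1\<^sub>m n))) = (\<Sum>m\<in>W. \<theta> (m (u - 1\<^sub>m n)))"
      unfolding W_def by (rule sum.UNION_disjoint[symmetric]) (use finC finO disj in auto)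
    finally show ?thesis .
  qed
  have lin: "strict_upper_linear n m" if "m \<in> W" for m
    using that two_sided_orbit_linear[OF \<pi>] by (auto simp: W_def Orb_def)
  have "\<theta> (m (1\<^sub>m n - 1\<^sub>m n)) = 1" if "m \<in> W" for m
  proof -
    \<comment> \<open>Homogeneity at the scalar 0 shows that \<open>m\<close> vanishes at the zero
      matrix, so every summand of the supercharacter at the identity is 1.\<close>
    have "m (0 \<cdot>\<^sub>m 0\<^sub>m n n) = 0 * m (0\<^sub>m n n)"
      using lin[OF that] strict_upper_zero unfolding strict_upper_linear_def by blast
    moreover have "(0 :: 'k) \<cdot>\<^sub>m 0\<^sub>m n n = 1\<^sub>m n - 1\<^sub>m n"
      by (auto intro!: eq_matI)
    ultimately have "m (1\<^sub>m n - 1\<^sub>m n) = 0" by (metis mult_zero_left)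
    then show ?thesis using \<theta> by (simp add: nontrivial_additive_character_def)
  qed
  then have one: "supercharacter \<theta> n \<pi> (1\<^sub>m n) = k * of_nat (card W)"
    by (simp add: chi)
  have U: "card ?U \<noteq> 0"
    by (simp add: card_eq_0_iff) (use one_unitriangular in blast)
  have "(\<Sum>u\<in>?U. supercharacter \<theta> n \<pi> u * cnj (supercharacter \<theta> n \<pi> u)) =
      (\<Sum>u\<in>?U. \<Sum>m\<in>W. \<Sum>m'\<in>W. k * k * (\<theta> (m (u - 1\<^sub>m n)) * cnj (\<theta> (m' (u - 1\<^sub>m n)))))"
  proof (rule sum.cong[OF refl])
    fix u
    have "cnj k = k" by (simp add: k_def)
    then show "supercharacter \<theta> n \<pi> u * cnj (supercharacter \<theta> n \<pi> u) =
      (\<Sum>m\<in>W. \<Sum>m'\<in>W. k * k * (\<theta> (m (u - 1\<^sub>m n)) * cnj (\<theta> (m' (u - 1\<^sub>m n)))))"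
      by (simp add: chi sum_product mult_ac flip: sum_distrib_left)
  qed
  also have "\<dots> = (\<Sum>m\<in>W. \<Sum>m'\<in>W. \<Sum>u\<in>?U. k * k * (\<theta> (m (u - 1\<^sub>m n)) * cnj (\<theta> (m' (u - 1\<^sub>m n)))))"
    by (subst sum.swap) (rule sum.cong[OF refl], rule sum.swap)
  \<comment> \<open>Orthogonality kills all pairs off the diagonal, leaving one equal term for each
    element of \<open>W\<close>.\<close>
  also have "\<dots> = (\<Sum>m\<in>W. \<Sum>m'\<in>W. if m = m' then k * k * of_nat (card ?U) else 0)"
    by (intro sum.cong refl)
      (simp add: character_orthogonality[OF \<theta> lin lin] flip: sum_distrib_left)
  also have "\<dots> = k * k * of_nat (card ?U) * of_nat (card W)"
    using finW by simp
  finally have "char_inner n (supercharacter \<theta> n \<pi>) (supercharacter \<theta> n \<pi>) = k * k * of_nat (card W)"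
    using U by (simp add: char_inner_def)
  \<comment> \<open>One factor \<open>card W\<close> and both factors \<open>k\<close> cancel. In
    the case \<open>card W = 0\<close> both sides are 0, because division by 0 yields 0.\<close>
  then show ?thesis
    using k by (cases "card W = 0") (auto simp: SPl_def one cardW[symmetric] power2_eq_square)
qed

theorem proposition3p4:
  fixes \<theta> :: "'k::{field,finite} \<Rightarrow> complex"
    and n :: nat
    and \<pi> :: "nat set set"
  assumes "nontrivial_additive_character \<theta>"
    and "n \<ge> 1"
    and "partition_on {1..n} \<pi>"
  shows "SPl \<theta> n \<pi> =
           complex_of_real (real (card (J_set n \<pi> :: 'k mat set)) /
                            real (card (unitriangular n :: 'k mat set)))
       \<and> SPl \<theta> n \<pi> =
           complex_of_real (measure_pmf.prob (pmf_of_set (unitriangular n :: 'k mat set))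
                                             (J_set n \<pi>))"
proof -
  let ?U = "unitriangular n :: 'k mat set" and ?J = "J_set n \<pi> :: 'k mat set"
  have "?U \<noteq> {}" using one_unitriangular by blast
  then have "measure_pmf.prob (pmf_of_set ?U) ?J = card (?U \<inter> ?J) / card ?U"
    by (rule measure_pmf_of_set) simp
  moreover have "?U \<inter> ?J = ?J" by (auto simp: J_set_def)
  ultimately show ?thesis
    using SPl_eq_card_J_set[OF assms(1,3)] by simp
qed

end
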